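(* Let $d\geq 2$. Let $F$ be a bounded convex subset of $\mathbb{R}^d$ with nonempty interior. For every $r\in(0,\infty)$, set $F_r:=\{x\in\mathbb{Z}^d : r^{-1}x\in F\}$. Then $\mu_{F_r,\mathsf{gcd}}$ converges weakly to the probability measure $\mu_{\infty,\mathsf{gcd}}$ on $\Omega_{\mathbb{N}}$ when $r$ goes to infinity.
   Context: $\mathbb{N}=\{0,1,2,\dots\}$. For a Polish space $X$, $\Omega_X:=X^{\mathbb{Z}^d}$ with the product topology ($\mathbb{N}$ is discrete); probability measures on $\Omega_X$ carry the weak topology. For $c\in\Omega_X$ and $F$ a nonempty finite subset of $\mathbb{Z}^d$, $\mu_{F,c}$ denotes the distribution of the random element $x\mapsto c(x+Y)$ of $\Omega_X$, where $Y$ is uniformly distributed in $F$. (Here $F_r$ is finite, and nonempty for $r$ large.) The map $\mathsf{gcd}\in\Omega_{\mathbb{N}}$ is $x\mapsto \gcd(x_1,\dots,x_d)$, with $\gcd(0,\dots,0)=0$. Definition of $\mu_{\infty,\mathsf{gcd}}$: independently for every prime $p$, set $\mathcal{W}_0^p:=\mathbb{Z}^d$ and, for each $n\ge 1$, conditionally on $(\mathcal{W}_0^p,\dots,\mathcal{W}_{n-1}^p)$, pick $\mathcal{W}_n^p$ uniformly among the cosets of $p^n\mathbb{Z}^d$ lying inside $\mathcal{W}_{n-1}^p$. For $x\in\mathbb{Z}^d$ let $V_p(x):=\sup\{n\in\mathbb{N} : x\in\mathcal{W}_n^p\}\in\{0,1,\dots\}\cup\{\infty\}$. Then $\mu_{\infty,\mathsf{gcd}}$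 is the distribution of the random map $x\mapsto\prod_{p\text{ prime}}p^{V_p(x)}$ (with the convention that the product is $0$ if $V_p(x)=\infty$ for all $p$). It is a priori a distribution on $(\mathbb{N}\cup\{\infty\})^{\mathbb{Z}^d}$; since $d\ge2$, by Borel--Cantelli all values are almost surely finite and it is regarded as a probability measure on $\Omega_{\mathbb{N}}$. *)

theory Defs
  imports "HOL-Probability.Probability" "HOL-Computational_Algebra.Primes"
begin

text \<open>\<open>\<int>\<^sup>d\<close> is \<open>int ^ 'n\<close> with \<open>d = CARD('n)\<close>, and \<open>X\<close>-valued maps on it are functions with the product
  topology of \<open>HOL-Analysis.Function_Topology\<close>. The type \<open>nat\<close> carries the discrete topology.\<close>

definition converges_weakly ::
  "('i \<Rightarrow> 'a::topological_space measure) \<Rightarrow> 'a measure \<Rightarrow> 'i filter \<Rightarrow> bool" where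
  "converges_weakly \<mu> \<nu> \<F> \<longleftrightarrow>
     (\<forall>f :: 'a \<Rightarrow> real. continuous_on UNIV f \<and> bounded (range f) \<longrightarrow>
        ((\<lambda>r. \<integral>\<omega>. f \<omega> \<partial>\<mu> r) \<longlongrightarrow> (\<integral>\<omega>. f \<omega> \<partial>\<nu>)) \<F>)"

definition shift_distr ::
  "(int ^ 'n) set \<Rightarrow> (int ^ 'n \<Rightarrow> 'x::topological_space) \<Rightarrow> (int ^ 'n \<Rightarrow> 'x) measure" where
  "shift_distr F c = distr (uniform_count_measure F) borel (\<lambda>y x. c (x + y))"

definition gcd_map :: "int ^ 'n \<Rightarrow> nat" where
  "gcd_map x = nat (GCD i. x $ i)"

definition lattice_points :: "(real ^ 'n) set \<Rightarrow> real \<Rightarrow> (int ^ 'n) set" where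
  "lattice_points F r = {x. inverse r *\<^sub>R (\<chi> i. real_of_int (x $ i)) \<in> F}"

definition cosets :: "nat \<Rightarrow> nat \<Rightarrow> (int ^ 'n) set set" where
  "cosets p n = range (\<lambda>a. range (\<lambda>z. a + int (p ^ n) *s z))"

text \<open>The conditional law of \<open>W\<^sub>n\<close> given \<open>(W\<^sub>0, \<dots>, W\<^sub>n\<^sub>-\<^sub>1)\<close>. For \<open>n = 0\<close> the only coset is \<open>UNIV\<close>.\<close>

definition coset_kernel ::
  "nat \<Rightarrow> nat \<Rightarrow> (nat \<Rightarrow> (int ^ 'n) set) \<Rightarrow> (int ^ 'n) set measure" where
  "coset_kernel p n W =
     uniform_measure (count_space (cosets p n)) {C \<in> cosets p n. n = 0 \<or> C \<subseteq> W (n - 1)}"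

lemma coset_eq: "range (\<lambda>z. a + int (p ^ n) *s z) = {x::int ^ 'n. \<forall>i. int (p ^ n) dvd x $ i - a $ i}"
proof (intro set_eqI iffI)
  fix x :: "int ^ 'n" assume "x \<in> {x. \<forall>i. int (p ^ n) dvd x $ i - a $ i}"
  then have "\<forall>i. \<exists>k. x $ i - a $ i = int (p ^ n) * k" by (auto simp: dvd_def)
  then obtain k where "\<And>i. x $ i - a $ i = int (p ^ n) * k i" by metis
  then have "x = a + int (p ^ n) *s (\<chi> i. k i)"
    by (auto simp: vec_eq_iff algebra_simps)
  then show "x \<in> range (\<lambda>z. a + int (p ^ n) *s z)" by blast
qed auto

lemma finite_cosets:
  assumes "p > 0" shows "finite (cosets p n :: (int ^ 'n) set set)"
proof -
  let ?B = "{a :: int ^ 'n. \<forall>i. a $ i \<in> {0..<int (p ^ n)}}"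
  have "?B \<subseteq> vec_lambda ` (PiE UNIV (\<lambda>_. {0..<int (p ^ n)}))"
  proof
    fix a assume "a \<in> ?B"
    then show "a \<in> vec_lambda ` (PiE UNIV (\<lambda>_. {0..<int (p ^ n)}))"
      by (intro image_eqI[of _ _ "\<lambda>i. a $ i"]) (auto simp: PiE_iff)
  qed
  then have "finite ?B" by (rule finite_subset) (auto intro!: finite_PiE)
  moreover have "(cosets p n :: (int ^ 'n) set set) \<subseteq> (\<lambda>a. range (\<lambda>z. a + int (p ^ n) *s z)) ` ?B"
  proof
    fix C :: "(int ^ 'n) set" assume "C \<in> cosets p n"
    then obtain a where C: "C = range (\<lambda>z. a + int (p ^ n) *s z)" by (auto simp: cosets_def)
    let ?b = "\<chi> i. a $ i mod int (p ^ n)"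
    have "int (p ^ n) dvd x - a $ i \<longleftrightarrow> int (p ^ n) dvd x - ?b $ i" for x i
      by (simp add: mod_eq_dvd_iff[symmetric] del: of_nat_power)
    then have "C = range (\<lambda>z. ?b + int (p ^ n) *s z)"
      unfolding C coset_eq by simp
    moreover have "?b \<in> ?B" using assms by simp
    ultimately show "C \<in> (\<lambda>a. range (\<lambda>z. a + int (p ^ n) *s z)) ` ?B" by blast
  qed
  ultimately show ?thesis by (meson finite_imageI finite_subset)
qed

lemma subcoset_exists:
  assumes "C \<in> cosets p n" shows "\<exists>D \<in> cosets p (Suc n). D \<subseteq> C"
proof -
  obtain a where C: "C = range (\<lambda>z. a + int (p ^ n) *s z)" using assms by (auto simp: cosets_def)
  have "range (\<lambda>z. a + int (p ^ Suc n) *s z) \<subseteq> C"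
    unfolding C coset_eq by (auto intro: dvd_trans[rotated])
  then show ?thesis unfolding cosets_def by blast
qed

lemma Ionescu_Tulcea_coset_kernel:
  assumes "p > 0"
  shows "Ionescu_Tulcea (coset_kernel p) (\<lambda>n. count_space (cosets p n :: (int ^ 'n) set set))"
proof -
  let ?M = "\<lambda>n. count_space (cosets p n :: (int ^ 'n) set set)"
  have pr: "prob_space (coset_kernel p n W)" if W: "W \<in> space (PiM {0..<n} ?M)" for n W
  proof -
    let ?S = "{C \<in> cosets p n. n = 0 \<or> C \<subseteq> W (n - 1)}"
    have "?S \<noteq> {}"
    proof (cases n)
      case 0 then show ?thesis by (auto simp: cosets_def)
    next
      case (Suc m)
      then have "W m \<in> cosets p m" using W by (auto simp: space_PiM PiE_iff)
      from subcoset_exists[OF this] Suc show ?thesis by auto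
    qed
    moreover have "finite ?S" by (rule finite_subset[OF _ finite_cosets[OF assms, of n]]) auto
    ultimately show ?thesis unfolding coset_kernel_def
      by (intro prob_space_uniform_measure) (auto simp: emeasure_count_space)
  qed
  show ?thesis
  proof (rule Ionescu_Tulcea.intro)
    fix n
    show "coset_kernel p n \<in> measurable (PiM {0..<n} ?M) (subprob_algebra (?M n))"
    proof (rule measurable_subprob_algebra)
      fix W assume "W \<in> space (PiM {0..<n} ?M)"
      from prob_space_imp_subprob_space[OF pr[OF this]] show "subprob_space (coset_kernel p n W)" .
      show "sets (coset_kernel p n W) = sets (?M n)" by (simp add: coset_kernel_def)
    next
      fix A assume "A \<in> sets (?M n)"
      show "(\<lambda>W. emeasure (coset_kernel p n W) A) \<in> borel_measurable (PiM {0..<n} ?M)"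
      proof (cases n)
        case 0
        then show ?thesis by (simp add: coset_kernel_def)
      next
        case (Suc m)
        have "(\<lambda>W. W m) \<in> measurable (PiM {0..<n} ?M) (?M m)"
          using Suc by (intro measurable_component_singleton) simp
        from measurable_compose[OF this, of "\<lambda>D. emeasure (uniform_measure (?M (Suc m))
            {C \<in> cosets p (Suc m). C \<subseteq> D}) A" borel]
        show ?thesis
          unfolding coset_kernel_def Suc by simp
      qed
    qed
  qed (rule pr)
qed

text \<open>The law of \<open>(W\<^sub>n\<^sup>p)\<^sub>n\<close> as the Ionescu-Tulcea limit of the kernels above, and the law
  of the whole family, independent over the primes \<open>p\<close>.\<close>

definition coset_chain :: "nat \<Rightarrow> (nat \<Rightarrow> (int ^ 'n) set) measure" where
  "coset_chain p = projective_family.lim UNIV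
     (Ionescu_Tulcea.CI (coset_kernel p) (\<lambda>n. count_space (cosets p n)))
     (\<lambda>n. count_space (cosets p n))"

definition coset_process :: "(nat \<Rightarrow> nat \<Rightarrow> (int ^ 'n) set) measure" where
  "coset_process = PiM {p. prime p} coset_chain"

definition coset_val :: "(nat \<Rightarrow> (int ^ 'n) set) \<Rightarrow> int ^ 'n \<Rightarrow> enat" where
  "coset_val W x = (SUP n \<in> {n. x \<in> W n}. enat n)"

text \<open>\<open>\<Prod>\<^sub>p p\<^bsup>v p\<^esup>\<close> over all primes in \<open>\<nat> \<union> {\<infinity>}\<close>.\<close>

definition prime_powers_prod :: "(nat \<Rightarrow> enat) \<Rightarrow> enat" where
  "prime_powers_prod v =
     (if \<forall>p. prime p \<longrightarrow> v p = \<infinity> then 0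
      else if (\<forall>p. prime p \<longrightarrow> v p \<noteq> \<infinity>) \<and> finite {p. prime p \<and> v p \<noteq> 0}
      then enat (\<Prod>p | prime p \<and> v p \<noteq> 0. p ^ the_enat (v p))
      else \<infinity>)"

definition random_gcd_map :: "(nat \<Rightarrow> nat \<Rightarrow> (int ^ 'n) set) \<Rightarrow> int ^ 'n \<Rightarrow> enat" where
  "random_gcd_map W x = prime_powers_prod (\<lambda>p. coset_val (W p) x)"

text \<open>For \<open>CARD('n) \<ge> 2\<close> the values of \<open>random_gcd_map\<close> are almost surely finite, so that the
  (unspecified) value of \<open>the_enat\<close> at \<open>\<infinity>\<close> plays no role.\<close>

definition mu_inf_gcd :: "(int ^ 'n \<Rightarrow> nat) measure" where
  "mu_inf_gcd = distr coset_process borel (\<lambda>W x. the_enat (random_gcd_map W x))"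

lemma coset_chain_props:
  assumes "p > 0" shows "prob_space (coset_chain p :: (nat \<Rightarrow> (int ^ 'n) set) measure)"
  "sets (coset_chain p :: (nat \<Rightarrow> (int ^ 'n) set) measure) = sets (PiM UNIV (\<lambda>n. count_space (cosets p n)))"
proof -
  interpret Ionescu_Tulcea "coset_kernel p" "\<lambda>n. count_space (cosets p n :: (int ^ 'n) set set)"
    by (rule Ionescu_Tulcea_coset_kernel[OF assms])
  show "sets (coset_chain p :: (nat \<Rightarrow> (int ^ 'n) set) measure) = sets (PiM UNIV (\<lambda>n. count_space (cosets p n)))"
    unfolding coset_chain_def by (rule PF.sets_lim)
  have emb: "space PF.lim = PF.emb UNIV {} (space (PiM {} (\<lambda>n. count_space (cosets p n :: (int ^ 'n) set set))))"
    by (auto simp: PF.space_lim prod_emb_def space_PiM)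
  show "prob_space (coset_chain p :: (nat \<Rightarrow> (int ^ 'n) set) measure)"
    unfolding coset_chain_def
    apply (rule prob_spaceI)
    apply (subst emb)
    apply (subst lim)
    apply simp_all
    using PF.prob_space_P[of "{}"] prob_space.emeasure_space_1 PF.space_P[of "{}"]
    by (metis empty_subsetI finite.emptyI)
qed

lemma measurable_prime_powers_prod:
  assumes [measurable]: "\<And>p. prime p \<Longrightarrow> (\<lambda>w. v w p) \<in> measurable M (count_space UNIV)"
  shows "(\<lambda>w. prime_powers_prod (v w)) \<in> measurable M (count_space UNIV)"
proof -
  have [measurable]: "Measurable.pred M (\<lambda>w. prime p \<and> v w p \<noteq> 0)" for p
    by (cases "prime p") auto
  have [measurable]: "Measurable.pred M (\<lambda>w. prime p \<longrightarrow> v w p = \<infinity>)"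
    "Measurable.pred M (\<lambda>w. prime p \<longrightarrow> v w p \<noteq> \<infinity>)" for p
    by (cases "prime p"; auto)+
  have eq: "finite {p. prime p \<and> v w p \<noteq> 0} \<longleftrightarrow> (\<exists>N. \<forall>p. p > N \<longrightarrow> \<not> (prime p \<and> v w p \<noteq> 0))" for w
    unfolding finite_nat_set_iff_bounded_le by (auto simp: not_less[symmetric])
  have [measurable]: "Measurable.pred M (\<lambda>w. finite {p. prime p \<and> v w p \<noteq> 0})"
    unfolding eq by measurable
  have prd: "Measurable.pred M (\<lambda>w. finite {p. prime p \<and> v w p \<noteq> 0} \<and> 
      (\<Prod>p | prime p \<and> v w p \<noteq> 0. p ^ the_enat (v w p)) = k)" for k
  proof -
    have cv: "(finite {p. prime p \<and> v w p \<noteq> 0} \<and> (\<Prod>p | prime p \<and> v w p \<noteq> 0. p ^ the_enat (v w p)) = k)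
      \<longleftrightarrow> (\<exists>N. (\<forall>p. p > N \<longrightarrow> \<not> (prime p \<and> v w p \<noteq> 0)) \<and> (\<Prod>p\<in>{..N}. if prime p \<and> v w p \<noteq> 0 then p ^ the_enat (v w p) else 1) = k)"
      for w
    proof -
      have *: "(\<Prod>p | prime p \<and> v w p \<noteq> 0. p ^ the_enat (v w p)) = (\<Prod>p\<in>{..N}. if prime p \<and> v w p \<noteq> 0 then p ^ the_enat (v w p) else 1)"
        if "\<forall>p. p > N \<longrightarrow> \<not> (prime p \<and> v w p \<noteq> 0)" for N
        using that by (intro prod.mono_neutral_cong_left) (auto simp: not_less[symmetric])
      have gen: "(\<exists>N. P N) \<and> X = k \<longleftrightarrow> (\<exists>N. P N \<and> Y N = k)" if "\<And>N. P N \<Longrightarrow> X = Y N"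
        for P :: "nat \<Rightarrow> bool" and X and Y :: "nat \<Rightarrow> nat"
        using that by blast
      show ?thesis unfolding eq by (rule gen[OF *])
    qed
    have B: "(\<lambda>w. if prime p \<and> v w p \<noteq> 0 then p ^ the_enat (v w p) else 1) \<in> measurable M (count_space UNIV)" for p
      by (cases "prime p") auto
    have [measurable]: "(\<lambda>w. \<Prod>p\<in>{..N}. if prime p \<and> v w p \<noteq> 0 then p ^ the_enat (v w p) else 1)
        \<in> measurable M (count_space UNIV)" for N
    proof (induction N)
      case (Suc N)
      have "(\<lambda>w. a * (if prime (Suc N) \<and> v w (Suc N) \<noteq> 0 then Suc N ^ the_enat (v w (Suc N)) else 1))
          \<in> measurable M (count_space UNIV)" for a :: nat
        by (rule measurable_compose[OF B]) simp
      from measurable_compose_countable[OF this Suc]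
      show ?case by (simp add: prod.atMost_Suc del: power_Suc)
    qed (use B[of 0] in simp)
    show ?thesis unfolding cv by measurable
  qed
  have [measurable]: "(\<lambda>w. \<Prod>p | prime p \<and> v w p \<noteq> 0. p ^ the_enat (v w p)) \<in> measurable M (count_space UNIV)"
  proof -
    have cv: "(\<Prod>p | prime p \<and> v w p \<noteq> 0. p ^ the_enat (v w p)) = k \<longleftrightarrow>
        (finite {p. prime p \<and> v w p \<noteq> 0} \<and> (\<Prod>p | prime p \<and> v w p \<noteq> 0. p ^ the_enat (v w p)) = k)
        \<or> (\<not> finite {p. prime p \<and> v w p \<noteq> 0} \<and> k = 1)" for w k
      by (cases "finite {p. prime p \<and> v w p \<noteq> 0}") auto
    have "Measurable.pred M (\<lambda>w. (\<Prod>p | prime p \<and> v w p \<noteq> 0. p ^ the_enat (v w p)) = k)" for k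
      by (subst cv, intro pred_intros_logic prd) measurable
    then show ?thesis
      by (subst measurable_count_space_eq2_countable) (auto simp: pred_def vimage_def Int_def conj_commute)
  qed
  show ?thesis
    unfolding prime_powers_prod_def[abs_def]
    by measurable
qed

lemma prob_space_mu_inf_gcd: "prob_space (mu_inf_gcd :: (int ^ 'n \<Rightarrow> nat) measure)"
proof -
  let ?C = "coset_chain :: nat \<Rightarrow> (nat \<Rightarrow> (int ^ 'n) set) measure"
  define K where "K p = (if prime p then ?C p else ?C 2)" for p
  have "prob_space (K p)" for p unfolding K_def
    by (auto intro!: coset_chain_props(1) prime_gt_0_nat)
  then interpret product_prob_space K "{p. prime p}"
    by (simp add: product_prob_space_def product_sigma_finite_def product_prob_space_axioms_def prob_space_imp_sigma_finite)
  have eq: "coset_process = PiM {p. prime p} K"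
    unfolding coset_process_def by (rule PiM_cong) (auto simp: K_def)
  have ps: "prob_space (coset_process :: (nat \<Rightarrow> nat \<Rightarrow> (int ^ 'n) set) measure)" unfolding eq by (rule prob_space_axioms)
  have a: "(\<lambda>W. W p n) \<in> measurable (coset_process :: (nat \<Rightarrow> nat \<Rightarrow> (int ^ 'n) set) measure) (count_space (cosets p n))" 
    if "prime p" for p n
  proof (rule measurable_compose[of "\<lambda>W. W p"])
    show "(\<lambda>W. W p) \<in> measurable (coset_process :: (nat \<Rightarrow> nat \<Rightarrow> (int ^ 'n) set) measure) (?C p)"
      unfolding coset_process_def using that by (intro measurable_component_singleton) simp
    show "(\<lambda>W. W n) \<in> measurable (?C p) (count_space (cosets p n))"
      by (subst measurable_cong_sets[OF coset_chain_props(2)[OF prime_gt_0_nat[OF that]] refl])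
        (rule measurable_component_singleton[OF UNIV_I])
  qed
  have b: "Measurable.pred coset_process (\<lambda>W. x \<in> W p n)" if "prime p" for p n and x :: "int ^ 'n"
    using measurable_compose[OF a[OF that], of "\<lambda>D. x \<in> D"] by simp
  have c: "(\<lambda>W. coset_val (W p) x) \<in> measurable coset_process (count_space UNIV)" if "prime p" for p and x :: "int ^ 'n"
  proof -
    note [measurable] = b[OF that]
    have le: "coset_val (W p) x \<le> enat m \<longleftrightarrow> (\<forall>n. x \<in> W p n \<longrightarrow> n \<le> m)" for W m
      by (auto simp: coset_val_def SUP_le_iff)
    have eq: "u = k \<longleftrightarrow> (\<forall>m. u \<le> enat m \<longleftrightarrow> k \<le> enat m)" for u k
    proof
      assume *: "\<forall>m. u \<le> enat m \<longleftrightarrow> k \<le> enat m"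
      show "u = k"
        using *[rule_format, of "the_enat u"] *[rule_format, of "the_enat k"]
        by (cases u; cases k) auto
    qed simp
    have "Measurable.pred coset_process (\<lambda>W. coset_val (W p) x = k)" for k
      by (subst eq, subst le, measurable)
    then show ?thesis
      by (subst measurable_count_space_eq2_countable) (auto simp: pred_def vimage_def Int_def conj_commute)
  qed
  have "(\<lambda>W x. the_enat (random_gcd_map W x)) \<in> measurable (coset_process :: (nat \<Rightarrow> nat \<Rightarrow> (int ^ 'n) set) measure) borel"
  proof (rule measurable_coordinatewise_then_product)
    fix x :: "int ^ 'n"
    have "(\<lambda>W. random_gcd_map W x) \<in> measurable coset_process (count_space UNIV)"
      unfolding random_gcd_map_def by (rule measurable_prime_powers_prod) (rule c)
    then show "(\<lambda>W. the_enat (random_gcd_map W x)) \<in> measurable coset_process borel"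
      by (rule measurable_compose) simp
  qed
  then show ?thesis unfolding mu_inf_gcd_def
    by (rule prob_space.prob_space_distr[OF ps])
qed

end

theory Submission
  imports Defs
begin

text \<open>
  Weak convergence to a probability measure on \<open>X\<^bsup>I\<^esup>\<close>, with \<open>I\<close> countable and \<open>X\<close> countable and
  discrete, is convergence of the probabilities of the events that prescribe finitely many coordinates
  (\<open>converges_weakly_cylinders\<close>). So the point is: for a finite \<open>A\<close> and prescribed values \<open>v\<close>,
  the proportion of \<open>y \<in> F\<^sub>r\<close> with \<open>gcd (x + y) = v x\<close> on \<open>A\<close> tends to the probability that the
  random map takes the values \<open>v\<close> on \<open>A\<close>. Both sides are compared after replacing every value
  \<open>k\<close> by \<open>gcd k M\<close> for a fixed modulus \<open>M\<close>, which is later \<open>N!\<close> with \<open>N \<rightarrow> \<infinity>\<close>.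

  On the random side only the cosets of \<open>p\<^sup>n\<int>\<^sup>d\<close> for the prime powers \<open>p\<^sup>n\<close> exactly dividing \<open>M\<close>
  matter. They are independent and uniform, so with probability one they are the cosets of one
  uniform residue \<open>u\<close> modulo \<open>M\<close>, and then the reduced random map is \<open>x \<mapsto> gcd (gcd (x - u)) M\<close>
  (\<open>mu_inf_gcd_mod\<close>). By Borel-Cantelli all values of the random map are finite and positive, and
  a positive \<open>k\<close> equals \<open>gcd k N!\<close> as soon as \<open>k \<le> N\<close> (\<open>mu_inf_gcd_cylinder_limit\<close>).

  On the arithmetic side the reduced map is periodic modulo \<open>M\<close>, so it is enough that each residue
  class modulo \<open>M\<close> has asymptotically the same share of \<open>F\<^sub>r\<close>
  (\<open>lattice_points_equidistributed\<close>). Each line parallel to a coordinate axis meets a convex set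
  in an interval, so translation by a unit vector moves out of \<open>F\<^sub>r\<close> at most one point per line. There are \<open>O(r\<^bsup>d-1\<^esup>)\<close> lines, whereas \<open>F\<^sub>r\<close> has
  at least a constant times \<open>r\<^sup>d\<close> points, for \<open>r\<close> large, because \<open>F\<close> contains a cube.

  The reduction modulo \<open>N!\<close> changes \<open>gcd (x + y)\<close> only if it is \<open>0\<close> or larger than \<open>N\<close>. A box of
  side comparable to \<open>r\<close> has \<open>O((r/q)\<^sup>d)\<close> nonzero points divisible by \<open>q\<close>, and
  \<open>\<Sum>\<^bsub>q>N\<^esub> q\<^bsup>-d\<^esup> \<le> 1/N\<close> for \<open>d \<ge> 2\<close>; so this concerns a proportion \<open>O(1/N)\<close> of the points,
  uniformly in \<open>r\<close> large (\<open>lattice_points_large_gcd\<close>). This uniformity is what allows the limits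
  \<open>r \<rightarrow> \<infinity>\<close> and \<open>N \<rightarrow> \<infinity>\<close> to be interchanged (\<open>tendsto_via_approximation\<close>).
\<close>

section \<open>Weak convergence and cylinder events\<close>

definition cylinder :: "'i set \<Rightarrow> ('i \<Rightarrow> 'a) \<Rightarrow> ('i \<Rightarrow> 'a) set" where
  "cylinder A v = {\<omega>. \<forall>x\<in>A. \<omega> x = v x}"

lemma open_finite_coordinates:
  fixes P :: "'i \<Rightarrow> 'a::discrete_topology \<Rightarrow> bool"
  assumes "finite A" shows "open {\<omega>. \<forall>x\<in>A. P x (\<omega> x)}"
proof -
  have "open {\<omega>. P x (\<omega> x)}" for x
    using open_vimage[OF Topological_Spaces.open_discrete[of "{a. P x a}"]
      continuous_on_product_coordinates[of x]]
    by (simp add: vimage_def)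
  then have "open (\<Inter>x\<in>A. {\<omega>. P x (\<omega> x)})"
    using assms by (intro open_INT) auto
  also have "(\<Inter>x\<in>A. {\<omega>. P x (\<omega> x)}) = {\<omega>. \<forall>x\<in>A. P x (\<omega> x)}"
    by auto
  finally show ?thesis .
qed

lemma sets_cylinder [measurable]:
  fixes v :: "'i \<Rightarrow> 'a::discrete_topology"
  shows "finite A \<Longrightarrow> cylinder A v \<in> sets borel"
  unfolding cylinder_def by (intro borel_open open_finite_coordinates)

lemma cylinder_subset_open:
  fixes U :: "('i \<Rightarrow> 'a::discrete_topology) set"
  assumes "open U" "\<omega> \<in> U"
  shows "\<exists>A. finite A \<and> cylinder A \<omega> \<subseteq> U"
proof -
  have "openin (product_topology (\<lambda>i. euclidean) UNIV) U"
    using assms(1) by (simp add: open_fun_def)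
  from product_topology_open_contains_basis[OF this assms(2)]
  obtain X where X: "\<omega> \<in> (\<Pi>\<^sub>E i\<in>UNIV. X i)" "finite {i. X i \<noteq> UNIV}" "(\<Pi>\<^sub>E i\<in>UNIV. X i) \<subseteq> U"
    by auto
  have "cylinder {i. X i \<noteq> UNIV} \<omega> \<subseteq> (\<Pi>\<^sub>E i\<in>UNIV. X i)"
    using X(1) by (auto simp: cylinder_def PiE_iff) (metis UNIV_I)
  with X show ?thesis by blast
qed

lemma finite_to_nat_le: "finite {x::'c::countable. to_nat x \<le> k}"
  by (rule finite_imageD[of to_nat]) (auto intro: finite_subset[of _ "{..k}"] inj_on_subset[OF inj_to_nat])

text \<open>The integrand is approximated from below by finite linear combinations of cylinder indicators,
  whose integrals converge by assumption.\<close>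

lemma lower_semicontinuity_of_integral:
  fixes \<mu> :: "'r \<Rightarrow> ('i::countable \<Rightarrow> 'a::{countable,discrete_topology}) measure"
    and f :: "('i \<Rightarrow> 'a) \<Rightarrow> real"
  assumes "prob_space \<nu>" and "sets \<nu> = sets borel"
    and \<mu>: "eventually (\<lambda>r. prob_space (\<mu> r) \<and> sets (\<mu> r) = sets borel) \<F>"
    and cyl: "\<And>A v. finite A \<Longrightarrow>
      ((\<lambda>r. measure (\<mu> r) (cylinder A v)) \<longlongrightarrow> measure \<nu> (cylinder A v)) \<F>"
    and cont: "continuous_on UNIV f" and f: "\<And>\<omega>. 0 \<le> f \<omega>" "\<And>\<omega>. f \<omega> \<le> B"
    and "a < (\<integral>\<omega>. f \<omega> \<partial>\<nu>)"
  shows "eventually (\<lambda>r. a < (\<integral>\<omega>. f \<omega> \<partial>\<mu> r)) \<F>"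
proof -
  define I where "I k = {i::'i. to_nat i \<le> k}" for k
  define V where "V k = {a::'a. to_nat a \<le> k}" for k
  have fin[simp]: "finite (I k)" "finite (PiE (I k) (\<lambda>_. V l))" for k l
    by (auto simp: I_def V_def finite_to_nat_le intro!: finite_PiE)
  \<comment> \<open>\<open>m k\<close> is the largest function below \<open>f\<close> that depends only on the coordinates in \<open>I k\<close>; it
    increases to \<open>f\<close> by continuity.\<close>
  define m where "m k \<omega> = (INF \<omega>'\<in>cylinder (I k) \<omega>. f \<omega>')" for k \<omega>
  have m_cong: "m k \<omega> = m k \<omega>'" if "\<And>i. i \<in> I k \<Longrightarrow> \<omega> i = \<omega>' i" for k \<omega> \<omega>'
    using that by (simp add: m_def cylinder_def)
  \<comment> \<open>\<open>g k l\<close> cuts \<open>m k\<close> off outside finitely many values, which leaves a finite sum. The limits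
    \<open>l \<rightarrow> \<infinity>\<close> and then \<open>k \<rightarrow> \<infinity>\<close> must be separate: \<open>\<omega>\<close> is bounded on each \<open>I k\<close>, but by no bound
    that is known in terms of \<open>k\<close>.\<close>
  define g where "g k l \<omega> = (\<Sum>v\<in>PiE (I k) (\<lambda>_. V l). m k v * indicator (cylinder (I k) v) \<omega>)" for k l \<omega>
  have g_eq: "g k l \<omega> = (if \<forall>i\<in>I k. \<omega> i \<in> V l then m k \<omega> else 0)" for k l \<omega>
  proof -
    have "\<omega> \<in> cylinder (I k) v \<longleftrightarrow> restrict \<omega> (I k) = v" if "v \<in> PiE (I k) (\<lambda>_. V l)" for v
      using that by (auto simp: cylinder_def fun_eq_iff PiE_iff extensional_def)
    then have "g k l \<omega> = (\<Sum>v\<in>PiE (I k) (\<lambda>_. V l). if restrict \<omega> (I k) = v then m k v else 0)"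
      unfolding g_def by (intro sum.cong refl) auto
    also have "\<dots> = (if restrict \<omega> (I k) \<in> PiE (I k) (\<lambda>_. V l) then m k (restrict \<omega> (I k)) else 0)"
      by simp
    also have "m k (restrict \<omega> (I k)) = m k \<omega>" by (rule m_cong) simp
    finally show ?thesis by (simp only: restrict_PiE_iff)
  qed
  have m_le: "m k \<omega> \<le> f \<omega>" for k \<omega>
    unfolding m_def using f(1) by (intro cINF_lower bdd_belowI[of _ 0]) (auto simp: cylinder_def)
  have m_nonneg: "0 \<le> m k \<omega>" for k \<omega>
    unfolding m_def using f(1) by (intro cINF_greatest) (auto simp: cylinder_def)
  have g_bounds: "0 \<le> g k l \<omega>" "g k l \<omega> \<le> f \<omega>" for k l \<omega>
    using m_nonneg m_le f(1) by (auto simp: g_eq)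
  have g_lim: "(\<lambda>l. g k l \<omega>) \<longlonglongrightarrow> m k \<omega>" for k \<omega>
  proof (rule tendsto_eventually, rule eventually_sequentiallyI)
    fix l assume "Max (to_nat ` \<omega> ` I k) \<le> l"
    then have "\<forall>i\<in>I k. \<omega> i \<in> V l"
      by (cases "I k = {}") (auto simp: V_def)
    then show "g k l \<omega> = m k \<omega>" by (simp add: g_eq)
  qed
  have m_lim: "(\<lambda>k. m k \<omega>) \<longlonglongrightarrow> f \<omega>" for \<omega>
  proof (rule order_tendstoI)
    fix b assume "b < f \<omega>"
    then obtain b' where b': "b < b'" "b' < f \<omega>" using dense by blast
    have "open (f -` {b'<..})" by (rule open_vimage[OF _ cont]) simp
    from cylinder_subset_open[OF this, of \<omega>] b'
    obtain A where A: "finite A" "cylinder A \<omega> \<subseteq> f -` {b'<..}" by auto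
    show "eventually (\<lambda>k. b < m k \<omega>) sequentially"
    proof (rule eventually_sequentiallyI)
      fix k assume "Max (to_nat ` A) \<le> k"
      with A(1) have "to_nat a \<le> k" if "a \<in> A" for a
        using that by (intro order_trans[OF Max_ge[of "to_nat ` A" "to_nat a"]]) auto
      then have "A \<subseteq> I k" by (auto simp: I_def)
      then have "cylinder (I k) \<omega> \<subseteq> cylinder A \<omega>" by (auto simp: cylinder_def)
      with A(2) have "b' \<le> m k \<omega>" unfolding m_def
        by (intro cINF_greatest) (auto simp: cylinder_def intro: less_imp_le)
      with b' show "b < m k \<omega>" by simp
    qed
  next
    fix b assume "f \<omega> < b"
    then show "eventually (\<lambda>k. m k \<omega> < b) sequentially"
      by (intro always_eventually allI) (rule le_less_trans[OF m_le])
  qed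
  have g_meas: "g k l \<in> borel_measurable borel" for k l
    unfolding g_def[abs_def] by measurable
  have m_meas: "m k \<in> borel_measurable borel" for k
    using g_lim g_meas by (rule borel_measurable_LIMSEQ_real)
  interpret \<nu>: prob_space \<nu> by fact
  have [measurable]: "f \<in> borel_measurable \<nu>" "m k \<in> borel_measurable \<nu>"
      "g k l \<in> borel_measurable \<nu>" for k l
    using borel_measurable_continuous_onI[OF cont] g_meas m_meas
    by (simp_all cong: measurable_cong_sets add: assms(2))
  have "(\<lambda>k. \<integral>\<omega>. m k \<omega> \<partial>\<nu>) \<longlonglongrightarrow> (\<integral>\<omega>. f \<omega> \<partial>\<nu>)"
  proof (rule integral_dominated_convergence[where w="\<lambda>_. B"])
    have "norm (m k \<omega>) \<le> B" for k \<omega>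
      using m_nonneg[of k \<omega>] m_le[of k \<omega>] f(2)[of \<omega>] by auto
    then show "AE \<omega> in \<nu>. norm (m k \<omega>) \<le> B" for k by simp
  qed (use m_lim in auto)
  with \<open>a < _\<close> obtain k where k: "a < (\<integral>\<omega>. m k \<omega> \<partial>\<nu>)"
    using order_tendstoD(1) eventually_happens'[OF sequentially_bot] by blast
  have "(\<lambda>l. \<integral>\<omega>. g k l \<omega> \<partial>\<nu>) \<longlonglongrightarrow> (\<integral>\<omega>. m k \<omega> \<partial>\<nu>)"
  proof (rule integral_dominated_convergence[where w="\<lambda>_. B"])
    have "norm (g k l \<omega>) \<le> B" for l \<omega>
      using g_bounds[of k l \<omega>] f(2)[of \<omega>] by auto
    then show "AE \<omega> in \<nu>. norm (g k l \<omega>) \<le> B" for l by simp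
  qed (use g_lim in auto)
  with k obtain l where l: "a < (\<integral>\<omega>. g k l \<omega> \<partial>\<nu>)"
    using order_tendstoD(1) eventually_happens'[OF sequentially_bot] by blast
  have int_g: "(\<integral>\<omega>. g k l \<omega> \<partial>M) = (\<Sum>v\<in>PiE (I k) (\<lambda>_. V l). m k v * measure M (cylinder (I k) v))"
    if "prob_space M" "sets M = sets borel" for M
  proof -
    interpret M: prob_space M by fact
    have *: "cylinder (I k) v \<in> sets M" for v by (simp add: that)
    then have "integrable M (\<lambda>\<omega>. m k v * indicator (cylinder (I k) v) \<omega>)" for v
      by (auto intro!: integrable_real_mult_indicator simp: M.emeasure_eq_measure)
    then have "(\<integral>\<omega>. g k l \<omega> \<partial>M) =
        (\<Sum>v\<in>PiE (I k) (\<lambda>_. V l). \<integral>\<omega>. m k v * indicator (cylinder (I k) v) \<omega> \<partial>M)"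
      unfolding g_def by (rule Bochner_Integration.integral_sum)
    also have "\<dots> = (\<Sum>v\<in>PiE (I k) (\<lambda>_. V l). m k v * measure M (cylinder (I k) v))"
      using sets.sets_into_space[OF *] by (simp add: Int_absorb2)
    finally show ?thesis .
  qed
  have "((\<lambda>r. \<Sum>v\<in>PiE (I k) (\<lambda>_. V l). m k v * measure (\<mu> r) (cylinder (I k) v)) \<longlongrightarrow>
      (\<Sum>v\<in>PiE (I k) (\<lambda>_. V l). m k v * measure \<nu> (cylinder (I k) v))) \<F>"
    by (intro tendsto_intros cyl) simp
  from order_tendstoD(1)[OF this] l int_g[OF assms(1,2)]
  have "eventually (\<lambda>r. a < (\<Sum>v\<in>PiE (I k) (\<lambda>_. V l). m k v * measure (\<mu> r) (cylinder (I k) v))) \<F>"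
    by simp
  with \<mu> show ?thesis
  proof eventually_elim
    case (elim r)
    interpret M: prob_space "\<mu> r" using elim by simp
    have f_meas: "f \<in> borel_measurable (\<mu> r)" and g_meas': "g k l \<in> borel_measurable (\<mu> r)"
      using borel_measurable_continuous_onI[OF cont] g_meas[of k l] elim
      by (simp_all cong: measurable_cong_sets)
    have "norm (g k l \<omega>) \<le> B" "norm (f \<omega>) \<le> B" for \<omega>
      using g_bounds[of k l \<omega>] f[of \<omega>] by auto
    then have "integrable (\<mu> r) (g k l)" "integrable (\<mu> r) f"
      using f_meas g_meas' by (auto intro!: M.integrable_const_bound[of _ B])
    then have "(\<integral>\<omega>. g k l \<omega> \<partial>\<mu> r) \<le> (\<integral>\<omega>. f \<omega> \<partial>\<mu> r)"
      using g_bounds by (intro integral_mono) auto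
    with elim int_g[of "\<mu> r"] show ?case by simp
  qed
qed

text \<open>Since the limit is a probability measure, the lower bounds for \<open>f + B\<close> and for \<open>B - f\<close>
  together give convergence.\<close>

proposition converges_weakly_cylinders:
  fixes \<mu> :: "'r \<Rightarrow> ('i::countable \<Rightarrow> 'a::{countable,discrete_topology}) measure"
  assumes \<nu>: "prob_space \<nu>" "sets \<nu> = sets borel"
    and \<mu>: "eventually (\<lambda>r. prob_space (\<mu> r) \<and> sets (\<mu> r) = sets borel) \<F>"
    and cyl: "\<And>A v. finite A \<Longrightarrow>
      ((\<lambda>r. measure (\<mu> r) (cylinder A v)) \<longlongrightarrow> measure \<nu> (cylinder A v)) \<F>"
  shows "converges_weakly \<mu> \<nu> \<F>"
  unfolding converges_weakly_def
proof (intro allI impI, elim conjE)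
  fix f :: "('i \<Rightarrow> 'a) \<Rightarrow> real"
  assume cont: "continuous_on UNIV f" and "bounded (range f)"
  then obtain B where B: "\<And>\<omega>. \<bar>f \<omega>\<bar> \<le> B" by (auto simp: bounded_iff)
  have int: "(\<integral>\<omega>. f \<omega> + B \<partial>M) = (\<integral>\<omega>. f \<omega> \<partial>M) + B"
      "(\<integral>\<omega>. B - f \<omega> \<partial>M) = B - (\<integral>\<omega>. f \<omega> \<partial>M)" 
    if "prob_space M" "sets M = sets borel" for M
  proof -
    interpret M: prob_space M by fact
    have "f \<in> borel_measurable M"
      using borel_measurable_continuous_onI[OF cont] by (simp cong: measurable_cong_sets add: that)
    then have "integrable M f" using B by (auto intro!: M.integrable_const_bound[of _ B])
    then show "(\<integral>\<omega>. f \<omega> + B \<partial>M) = (\<integral>\<omega>. f \<omega> \<partial>M) + B"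
      "(\<integral>\<omega>. B - f \<omega> \<partial>M) = B - (\<integral>\<omega>. f \<omega> \<partial>M)" by (simp_all add: M.prob_space)
  qed
  note lower = lower_semicontinuity_of_integral[OF \<nu> \<mu> cyl, where B="2 * B"]
  have bnd: "0 \<le> f \<omega> + B" "f \<omega> + B \<le> 2 * B" "0 \<le> B - f \<omega>" "B - f \<omega> \<le> 2 * B" for \<omega>
    using B[of \<omega>] by auto
  show "((\<lambda>r. \<integral>\<omega>. f \<omega> \<partial>\<mu> r) \<longlongrightarrow> (\<integral>\<omega>. f \<omega> \<partial>\<nu>)) \<F>"
  proof (rule order_tendstoI)
    fix a assume "a < (\<integral>\<omega>. f \<omega> \<partial>\<nu>)"
    then have "eventually (\<lambda>r. a + B < (\<integral>\<omega>. f \<omega> + B \<partial>\<mu> r)) \<F>"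
      using bnd by (intro lower) (auto intro!: continuous_intros cont simp: int[OF \<nu>])
    with \<mu> show "eventually (\<lambda>r. a < (\<integral>\<omega>. f \<omega> \<partial>\<mu> r)) \<F>"
      by eventually_elim (simp add: int)
  next
    fix a assume "(\<integral>\<omega>. f \<omega> \<partial>\<nu>) < a"
    then have "eventually (\<lambda>r. B - a < (\<integral>\<omega>. B - f \<omega> \<partial>\<mu> r)) \<F>"
      using bnd by (intro lower) (auto intro!: continuous_intros cont simp: int[OF \<nu>])
    with \<mu> show "eventually (\<lambda>r. (\<integral>\<omega>. f \<omega> \<partial>\<mu> r) < a) \<F>"
      by eventually_elim (simp add: int)
  qed
qed

section \<open>Residue classes of integer vectors\<close>

definition residue_class :: "nat \<Rightarrow> int ^ 'n \<Rightarrow> (int ^ 'n) set" where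
  "residue_class M a = {x. \<forall>i. int M dvd x $ i - a $ i}"

lemma residue_class_self [simp]: "a \<in> residue_class M a"
  by (simp add: residue_class_def)

lemma residue_class_cong: "b \<in> residue_class M a \<Longrightarrow> residue_class M b = residue_class M a"
  by (auto simp: residue_class_def mod_eq_dvd_iff[symmetric])

lemma residue_class_mono: "M dvd N \<Longrightarrow> residue_class N a \<subseteq> residue_class M a"
  by (auto simp: residue_class_def intro: dvd_trans[of "int M" "int N"])

lemma cosets_eq_residue_classes: "cosets p n = range (residue_class (p ^ n))"
  by (simp add: cosets_def coset_eq residue_class_def del: of_nat_power)

lemma residue_class_in_cosets [simp]: "residue_class (p ^ n) a \<in> cosets p n"
  by (simp add: cosets_eq_residue_classes)

lemma coset_eq_residue_class:
  assumes "C \<in> cosets p n" "x \<in> C" shows "C = residue_class (p ^ n) x"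
  using assms by (auto simp: cosets_eq_residue_classes dest: residue_class_cong)

lemma
  fixes S :: "'n::finite \<Rightarrow> int set"
  assumes "\<And>i. finite (S i)"
  shows finite_int_box: "finite {x :: int ^ 'n. \<forall>i. x $ i \<in> S i}"
    and card_int_box: "card {x :: int ^ 'n. \<forall>i. x $ i \<in> S i} = (\<Prod>i\<in>UNIV. card (S i))"
proof -
  have "bij_betw (\<lambda>x. vec_nth x) {x :: int ^ 'n. \<forall>i. x $ i \<in> S i} (PiE UNIV S)"
    by (rule bij_betw_byWitness[where f'=vec_lambda]) (auto simp: PiE_iff)
  from bij_betw_same_card[OF this] bij_betw_finite[OF this]
  show "finite {x :: int ^ 'n. \<forall>i. x $ i \<in> S i}"
    "card {x :: int ^ 'n. \<forall>i. x $ i \<in> S i} = (\<Prod>i\<in>UNIV. card (S i))"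
    using assms by (simp_all add: card_PiE finite_PiE)
qed

definition residues :: "nat \<Rightarrow> (int ^ 'n) set" where
  "residues M = {u. \<forall>i. u $ i \<in> {0..<int M}}"

lemma finite_residues [simp]: "finite (residues M)"
  unfolding residues_def by (rule finite_int_box) simp

lemma card_residues: "card (residues M :: (int ^ 'n) set) = M ^ CARD('n)"
  unfolding residues_def by (subst card_int_box) simp_all

text \<open>With \<open>residues_exists\<close>: \<open>residues M\<close> is a system of representatives modulo \<open>M\<close>.\<close>

lemma residues_unique:
  assumes "u \<in> residues M" "u' \<in> residues M" "u' \<in> residue_class M u"
  shows "u' = u"
proof -
  have "u' $ i mod int M = u $ i mod int M" for i
    using assms(3) by (simp add: residue_class_def mod_eq_dvd_iff)
  then show ?thesis using assms(1,2) by (auto simp: vec_eq_iff residues_def)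
qed

lemma residues_exists:
  assumes "M > 0" shows "\<exists>u\<in>residues M. x \<in> residue_class M u"
  using assms by (intro bexI[of _ "\<chi> i. x $ i mod int M"])
    (auto simp: residues_def residue_class_def mod_eq_dvd_iff[symmetric])

section \<open>The law of the nested random cosets of one prime\<close>

text \<open>The subcosets of \<open>a + p\<^sup>m\<int>\<^sup>d\<close> are those of \<open>a + p\<^sup>m b\<close> for \<open>b\<close> modulo \<open>p\<close>.\<close>

lemma card_subcosets:
  assumes "p > 0" and "C \<in> cosets p m"
  shows "card {D \<in> cosets p (Suc m). D \<subseteq> (C :: (int ^ 'n) set)} = p ^ CARD('n)"
proof -
  obtain a where C: "C = residue_class (p ^ m) a"
    using assms(2) by (auto simp: cosets_eq_residue_classes)
  let ?D = "\<lambda>b. residue_class (p ^ Suc m) (a + int (p ^ m) *s b)"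
  have pm: "int p ^ m \<noteq> 0" using assms(1) by simp
  have "bij_betw ?D (residues p) {D \<in> cosets p (Suc m). D \<subseteq> C}"
  proof (rule bij_betwI')
    fix b b' :: "int ^ 'n" assume b: "b \<in> residues p" "b' \<in> residues p"
    show "?D b = ?D b' \<longleftrightarrow> b = b'"
    proof
      assume "?D b = ?D b'"
      then have "a + int (p ^ m) *s b \<in> ?D b'" by (metis residue_class_self)
      then have "int p ^ m * int p dvd int p ^ m * (b $ i - b' $ i)" for i
        by (simp add: residue_class_def algebra_simps)
      then have "int p dvd b $ i - b' $ i" for i
        using pm by (metis dvd_mult_cancel_left)
      then have "b \<in> residue_class p b'" by (simp add: residue_class_def)
      then show "b = b'" by (rule residues_unique[OF b(2,1)])
    qed simp
  next
    fix b :: "int ^ 'n" assume "b \<in> residues p"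
    have "a + int (p ^ m) *s b \<in> residue_class (p ^ m) a" by (simp add: residue_class_def)
    from residue_class_cong[OF this] residue_class_mono[of "p ^ m" "p ^ Suc m" "a + int (p ^ m) *s b"]
    show "?D b \<in> {D \<in> cosets p (Suc m). D \<subseteq> C}"
      using residue_class_in_cosets[of p "Suc m"] by (simp add: C)
  next
    fix D assume "D \<in> {D \<in> cosets p (Suc m). D \<subseteq> C}"
    then obtain c where D: "D = residue_class (p ^ Suc m) c" and "D \<subseteq> C"
      by (auto simp: cosets_eq_residue_classes)
    then have "c \<in> residue_class (p ^ m) a" using C by auto
    then have "\<forall>i. \<exists>z. c $ i = a $ i + int p ^ m * z"
      by (auto simp: residue_class_def dvd_def algebra_simps)
    then obtain z where z: "\<And>i. c $ i = a $ i + int p ^ m * z i" by metis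
    obtain b :: "int ^ 'n" where b: "b \<in> residues p" "(\<chi> i. z i) \<in> residue_class p b"
      using residues_exists[OF assms(1)] by blast
    have "int p ^ m * int p dvd int p ^ m * (z i - b $ i)" for i
      using b(2) by (intro mult_dvd_mono) (auto simp: residue_class_def)
    then have "c \<in> ?D b" using z by (simp add: residue_class_def algebra_simps)
    then have "D = ?D b" unfolding D by (rule residue_class_cong)
    with b(1) show "\<exists>b\<in>residues p. D = ?D b" by blast
  qed
  from bij_betw_same_card[OF this] show ?thesis by (simp add: card_residues)
qed

lemma coset_kernel_Suc:
  assumes "p > 0" and "D \<in> cosets p m" and "X \<subseteq> cosets p (Suc m)" and W: "W m = (D :: (int ^ 'n) set)"
  shows "emeasure (coset_kernel p (Suc m) W) X =
    ennreal (card {C \<in> X. C \<subseteq> D} / real p ^ CARD('n))"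
proof -
  let ?S = "{C \<in> cosets p (Suc m). C \<subseteq> D}"
  have fin: "finite ?S" "finite {C \<in> X. C \<subseteq> D}"
    using finite_cosets[OF assms(1), of "Suc m"] assms(3) by (auto intro: finite_subset)
  have eq: "?S \<inter> X = {C \<in> X. C \<subseteq> D}" using assms(3) by auto
  have "emeasure (coset_kernel p (Suc m) W) X =
     emeasure (count_space (cosets p (Suc m))) (?S \<inter> X) / emeasure (count_space (cosets p (Suc m))) ?S"
    unfolding coset_kernel_def using assms by (subst emeasure_uniform_measure) auto
  also have "\<dots> = of_nat (card {C \<in> X. C \<subseteq> D}) / of_nat (p ^ CARD('n))"
    unfolding eq using assms(3) fin
    by (subst (1 2) emeasure_count_space_finite) (auto simp: card_subcosets[OF assms(1,2)])
  also have "\<dots> = ennreal (card {C \<in> X. C \<subseteq> D} / real p ^ CARD('n))"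
    using assms(1) by (simp add: ennreal_of_nat_eq_real_of_nat divide_ennreal del: of_nat_power)
  finally show ?thesis .
qed

context
  fixes p :: nat and CS :: "nat \<Rightarrow> (int ^ 'n) set measure"
  assumes p: "p > 0"
  defines "CS \<equiv> \<lambda>n. count_space (cosets p n)"
begin

interpretation IT: Ionescu_Tulcea "coset_kernel p" CS
  unfolding CS_def by (rule Ionescu_Tulcea_coset_kernel[OF p])

lemma sets_coset_chain_PiM: "sets (coset_chain p) = sets (PiM UNIV CS)"
  by (simp add: coset_chain_props(2)[OF p] CS_def)

lemma space_coset_chain_PiM: "space (coset_chain p) = space (PiM UNIV CS)"
  by (rule sets_eq_imp_space_eq[OF sets_coset_chain_PiM])

lemma space_coset_prefix: "space (IT.C 0 n (\<lambda>_. undefined)) = space (PiM {0..<n} CS)"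
  using IT.space_C[of "\<lambda>_. undefined" 0 n] by (simp add: space_PiM)

text \<open>The Ionescu-Tulcea limit restricted to the first \<open>n\<close> coordinates is the \<open>n\<close>-fold composition
  of the kernels.\<close>

lemma coset_chain_prefix:
  assumes X: "X \<in> sets (PiM {0..<n} CS)"
  shows "emeasure (coset_chain p) {W \<in> space (coset_chain p). restrict W {0..<n} \<in> X} =
    emeasure (IT.C 0 n (\<lambda>_. undefined)) X"
proof -
  have "{W \<in> space (coset_chain p). restrict W {0..<n} \<in> X} = IT.PF.emb UNIV {0..<n} X"
    unfolding space_coset_chain_PiM by (auto simp: prod_emb_def space_PiM)
  then have "emeasure (coset_chain p) {W \<in> space (coset_chain p). restrict W {0..<n} \<in> X} =
     emeasure IT.PF.lim (IT.PF.emb UNIV {0..<n} X)"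
    by (simp add: coset_chain_def CS_def)
  also have "\<dots> = emeasure (IT.CI {0..<n}) X" by (intro IT.lim X) simp
  also have "\<dots> = emeasure (IT.C 0 n (\<lambda>_. undefined)) (IT.PF.emb {0..<n} {0..<n} X)"
    by (intro IT.emeasure_CI X) simp
  also have "IT.PF.emb {0..<n} {0..<n} X = X"
    using sets.sets_into_space[OF X] by (auto simp: prod_emb_def space_PiM)
  finally show ?thesis .
qed

lemma emeasure_coset_prefix_Suc:
  assumes X: "X \<in> sets (PiM {0..<Suc n} CS)"
  shows "emeasure (IT.C 0 (Suc n) (\<lambda>_. undefined)) X =
    (\<integral>\<^sup>+ W. emeasure (coset_kernel p n W) {C \<in> cosets p n. W(n := C) \<in> X} \<partial>IT.C 0 n (\<lambda>_. undefined))"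
proof -
  have u: "(\<lambda>_. undefined) \<in> space (PiM {0..<0} CS)" by (simp add: space_PiM)
  have ne: "space (IT.C 0 n (\<lambda>_. undefined)) \<noteq> {}"
    using IT.prob_space_C[OF u, of n] by (rule prob_space.not_empty)
  have "emeasure (IT.C 0 (Suc n) (\<lambda>_. undefined)) X =
     (\<integral>\<^sup>+ W. emeasure (IT.eP n W) X \<partial>IT.C 0 n (\<lambda>_. undefined))"
    using IT.measurable_eP[of n] IT.sets_C[OF u, of n] ne X
    by (simp, subst emeasure_bind[where N="PiM {0..<Suc n} CS"]) (auto cong: measurable_cong_sets)
  also have "\<dots> = (\<integral>\<^sup>+ W. emeasure (coset_kernel p n W) {C \<in> cosets p n. W(n := C) \<in> X}
      \<partial>IT.C 0 n (\<lambda>_. undefined))"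
  proof (intro nn_integral_cong)
    fix W assume "W \<in> space (IT.C 0 n (\<lambda>_. undefined))"
    then have "W \<in> space (PiM {0..<n} CS)" by (simp only: space_coset_prefix)
    from IT.emeasure_eP[OF this X]
    show "emeasure (IT.eP n W) X = emeasure (coset_kernel p n W) {C \<in> cosets p n. W(n := C) \<in> X}"
      by (simp add: CS_def vimage_def Int_def conj_commute)
  qed
  finally show ?thesis .
qed

lemma measurable_coset_prefix:
  "n \<in> I \<Longrightarrow> (\<lambda>W. W n) \<in> measurable (PiM I CS) (count_space (cosets p n))"
  using measurable_component_singleton[of n I CS] by (simp add: CS_def)

lemma pred_coset_prefix:
  "n \<in> I \<Longrightarrow> Measurable.pred (PiM I CS) (\<lambda>W. P (W n))"
  by (rule measurable_compose[OF measurable_coset_prefix]) simp_all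

lemma sets_not_nested:
  assumes "m \<in> I" "Suc m \<in> I"
  shows "{W \<in> space (PiM I CS). \<not> W (Suc m) \<subseteq> W m} \<in> sets (PiM I CS)"
proof -
  have "{W \<in> space (PiM I CS). \<not> W (Suc m) \<subseteq> W m} =
      {W \<in> space (PiM I CS). \<exists>D\<in>cosets p m. W m = D \<and> \<not> W (Suc m) \<subseteq> D}"
    using assms(1) by (auto simp: space_PiM CS_def PiE_iff)
  also have "\<dots> \<in> sets (PiM I CS)"
    using pred_coset_prefix[OF assms(1), measurable] pred_coset_prefix[OF assms(2), measurable]
      finite_cosets[OF p, of m] by measurable
  finally show ?thesis .
qed

text \<open>\<open>W\<^sub>n\<close> is uniform among the \<open>p\<^bsup>nd\<^esup>\<close> cosets of \<open>p\<^sup>n\<int>\<^sup>d\<close>: the event \<open>W\<^sub>m\<^sub>+\<^sub>1 = C\<close> forces \<open>W\<^sub>m\<close> to be the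
  one coset of \<open>p\<^sup>m\<int>\<^sup>d\<close> that contains \<open>C\<close>, and then has conditional probability \<open>p\<^bsup>-d\<^esup>\<close>.\<close>

lemma emeasure_coset_prefix:
  assumes "C \<in> cosets p n"
  shows "emeasure (IT.C 0 (Suc n) (\<lambda>_. undefined)) {W \<in> space (PiM {0..<Suc n} CS). W n = C} =
    ennreal (1 / real (p ^ n) ^ CARD('n))"
  using assms
proof (induction n arbitrary: C)
  case 0
  have u: "(\<lambda>_. undefined) \<in> space (PiM {0..<0} CS)" by (simp add: space_PiM)
  interpret P0: prob_space "IT.C 0 (Suc 0) (\<lambda>_. undefined)" using u by (rule IT.prob_space_C)
  have "C = UNIV" "cosets p 0 = {UNIV :: (int ^ 'n) set}"
    using 0 by (auto simp: cosets_eq_residue_classes residue_class_def)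
  then have "W 0 = C" if "W \<in> space (PiM {0..<Suc 0} CS)" for W
    using that unfolding space_PiM CS_def by (auto simp: PiE_iff)
  then have "{W \<in> space (PiM {0..<Suc 0} CS). W 0 = C} = space (IT.C 0 (Suc 0) (\<lambda>_. undefined))"
    unfolding space_coset_prefix by auto
  then show ?case using P0.emeasure_space_1 by simp
next
  case (Suc m)
  obtain c where C: "C = residue_class (p ^ Suc m) c"
    using Suc.prems by (auto simp: cosets_eq_residue_classes)
  define C' where "C' = residue_class (p ^ m) c"
  have C'_iff: "C \<subseteq> D \<longleftrightarrow> D = C'" if "D \<in> cosets p m" for D
  proof
    assume "C \<subseteq> D" then have "c \<in> D" using C by auto
    with that show "D = C'" unfolding C'_def by (rule coset_eq_residue_class)
  qed (auto simp: C C'_def residue_class_mono del: subsetI)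
  let ?P = "IT.C 0 (Suc m) (\<lambda>_. undefined)"
  let ?X = "{W \<in> space (PiM {0..<Suc (Suc m)} CS). W (Suc m) = C}"
  let ?Y = "{W \<in> space (PiM {0..<Suc m} CS). W m = C'}"
  have X: "?X \<in> sets (PiM {0..<Suc (Suc m)} CS)"
    using pred_coset_prefix[of "Suc m" _ "\<lambda>D. D = C"] by (simp add: pred_def)
  have Y: "?Y \<in> sets ?P"
    using pred_coset_prefix[of m _ "\<lambda>D. D = C'"] IT.sets_C[of "\<lambda>_. undefined" 0 "Suc m"]
    by (simp add: pred_def space_PiM)
  have "emeasure (IT.C 0 (Suc (Suc m)) (\<lambda>_. undefined)) ?X =
    (\<integral>\<^sup>+ W. emeasure (coset_kernel p (Suc m) W) {D \<in> cosets p (Suc m). W(Suc m := D) \<in> ?X} \<partial>?P)"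
    by (rule emeasure_coset_prefix_Suc[OF X])
  also have "\<dots> = (\<integral>\<^sup>+ W. ennreal (1 / real p ^ CARD('n)) * indicator ?Y W \<partial>?P)"
  proof (intro nn_integral_cong)
    fix W assume "W \<in> space ?P"
    then have W: "W \<in> space (PiM {0..<Suc m} CS)" by (simp only: space_coset_prefix)
    then have Wm: "W m \<in> cosets p m" by (auto simp: space_PiM CS_def PiE_iff)
    have "W(Suc m := D) \<in> space (PiM {0..<Suc (Suc m)} CS)" if "D \<in> cosets p (Suc m)" for D
      using W that by (auto simp: space_PiM CS_def PiE_iff extensional_def less_Suc_eq)
    then have "{D \<in> cosets p (Suc m). W(Suc m := D) \<in> ?X} = {C}" using Suc.prems by auto
    moreover have "{D. D = C \<and> D \<subseteq> W m} = (if W m = C' then {C} else {})"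
      using C'_iff[OF Wm] by auto
    ultimately show "emeasure (coset_kernel p (Suc m) W) {D \<in> cosets p (Suc m). W(Suc m := D) \<in> ?X}
        = ennreal (1 / real p ^ CARD('n)) * indicator ?Y W"
      using coset_kernel_Suc[OF p Wm, of "{C}" W] Suc.prems W by (simp add: indicator_def)
  qed
  also have "\<dots> = ennreal (1 / real p ^ CARD('n)) * emeasure ?P ?Y"
    by (rule nn_integral_cmult_indicator[OF Y])
  also have "\<dots> = ennreal (1 / real p ^ CARD('n)) * ennreal (1 / real (p ^ m) ^ CARD('n))"
    by (subst Suc.IH) (simp_all add: C'_def)
  also have "\<dots> = ennreal (1 / real (p ^ Suc m) ^ CARD('n))"
    by (simp add: ennreal_mult[symmetric] power_mult_distrib)
  finally show ?case .
qed

lemma emeasure_coset_chain: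
  fixes C :: "(int ^ 'n) set"
  assumes "C \<in> cosets p n"
  shows "emeasure (coset_chain p) {W \<in> space (coset_chain p). W n = C} =
    ennreal (1 / real (p ^ n) ^ CARD('n))"
proof -
  let ?X = "{W \<in> space (PiM {0..<Suc n} CS). W n = C}"
  have X: "?X \<in> sets (PiM {0..<Suc n} CS)"
    using pred_coset_prefix[of n _ "\<lambda>D. D = C"] by (simp add: pred_def)
  have "{W \<in> space (coset_chain p). W n = C} = {W \<in> space (coset_chain p). restrict W {0..<Suc n} \<in> ?X}"
    unfolding space_coset_chain_PiM by (auto simp: space_PiM)
  with coset_chain_prefix[OF X] emeasure_coset_prefix[OF assms] show ?thesis by simp
qed

lemma AE_coset_chain_nested: "AE W in coset_chain p. \<forall>m. W (Suc m) \<subseteq> (W m :: (int ^ 'n) set)"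
  unfolding AE_all_countable
proof
  fix m
  let ?X = "{W \<in> space (PiM {0..<Suc (Suc m)} CS). \<not> W (Suc m) \<subseteq> W m}"
  have X: "?X \<in> sets (PiM {0..<Suc (Suc m)} CS)" by (rule sets_not_nested) auto
  have "emeasure (IT.C 0 (Suc (Suc m)) (\<lambda>_. undefined)) ?X = (\<integral>\<^sup>+ W. 0 \<partial>IT.C 0 (Suc m) (\<lambda>_. undefined))"
    unfolding emeasure_coset_prefix_Suc[OF X]
  proof (intro nn_integral_cong)
    fix W assume "W \<in> space (IT.C 0 (Suc m) (\<lambda>_. undefined))"
    then have W: "W \<in> space (PiM {0..<Suc m} CS)" by (simp only: space_coset_prefix)
    then have Wm: "W m \<in> cosets p m" by (auto simp: space_PiM CS_def PiE_iff)
    have "{C. (C \<in> cosets p (Suc m) \<and> W(Suc m := C) \<in> ?X) \<and> C \<subseteq> W m} = {}" by auto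
    then show "emeasure (coset_kernel p (Suc m) W) {C \<in> cosets p (Suc m). W(Suc m := C) \<in> ?X} = 0"
      by (subst coset_kernel_Suc[OF p Wm]) auto
  qed
  then have "emeasure (coset_chain p) {W \<in> space (coset_chain p). restrict W {0..<Suc (Suc m)} \<in> ?X} = 0"
    using coset_chain_prefix[OF X] by simp
  moreover have "{W \<in> space (coset_chain p). restrict W {0..<Suc (Suc m)} \<in> ?X} = 
      {W \<in> space (coset_chain p). \<not> W (Suc m) \<subseteq> W m}"
    unfolding space_coset_chain_PiM by (auto simp: space_PiM)
  moreover have "{W \<in> space (coset_chain p). \<not> W (Suc m) \<subseteq> (W m :: (int ^ 'n) set)} \<in> sets (coset_chain p)"
    unfolding space_coset_chain_PiM sets_coset_chain_PiM by (rule sets_not_nested) auto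
  ultimately show "AE W in coset_chain p. W (Suc m) \<subseteq> (W m :: (int ^ 'n) set)"
    by (intro AE_I[of _ _ "{W \<in> space (coset_chain p). \<not> W (Suc m) \<subseteq> W m}"]) auto
qed

end

section \<open>The random gcd map\<close>

lemma prob_space_coset_process:
  "prob_space (coset_process :: (nat \<Rightarrow> nat \<Rightarrow> (int ^ 'n) set) measure)"
  unfolding coset_process_def
  by (rule prob_space_PiM) (simp add: coset_chain_props(1) prime_gt_0_nat)

lemma space_coset_chain:
  assumes "p > 0"
  shows "space (coset_chain p) = {W. \<forall>n. W n \<in> (cosets p n :: (int ^ 'n) set set)}"
  using sets_eq_imp_space_eq[OF coset_chain_props(2)[OF assms, where 'n='n]]
  by (auto simp: space_PiM PiE_iff)

lemma pred_coset_chain: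
  fixes P :: "(int ^ 'n) set \<Rightarrow> bool"
  assumes "p > 0"
  shows "Measurable.pred (coset_chain p) (\<lambda>W. P (W n))"
proof (rule measurable_compose[of "\<lambda>W. W n" _ "count_space (cosets p n)"])
  show "(\<lambda>W. W n) \<in> measurable (coset_chain p) (count_space (cosets p n :: (int ^ 'n) set set))"
    by (subst measurable_cong_sets[OF coset_chain_props(2)[OF assms] refl])
      (rule measurable_component_singleton[OF UNIV_I])
qed simp

lemma coset_process_in_cosets:
  assumes "W \<in> space (coset_process :: (nat \<Rightarrow> nat \<Rightarrow> (int ^ 'n) set) measure)" "prime p"
  shows "W p n \<in> cosets p n"
proof -
  have "W p \<in> space (coset_chain p)"
    using assms by (auto simp: coset_process_def space_PiM PiE_iff)
  then show ?thesis using assms(2) by (simp add: space_coset_chain prime_gt_0_nat)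
qed

lemma pred_coset_process:
  fixes P :: "(int ^ 'n) set \<Rightarrow> bool"
  assumes "prime p"
  shows "Measurable.pred coset_process (\<lambda>W. P (W p n))"
proof (rule measurable_compose[of "\<lambda>W. W p"])
  show "(\<lambda>W. W p) \<in> measurable (coset_process :: (nat \<Rightarrow> nat \<Rightarrow> (int ^ 'n) set) measure) (coset_chain p)"
    unfolding coset_process_def using assms by (intro measurable_component_singleton) simp
qed (rule pred_coset_chain[OF prime_gt_0_nat[OF assms]])

lemma measure_coset_process:
  fixes C :: "nat \<Rightarrow> (int ^ 'n) set"
  assumes "finite J" and J: "\<And>p. p \<in> J \<Longrightarrow> prime p" and C: "\<And>p. p \<in> J \<Longrightarrow> C p \<in> cosets p (k p)"
  shows "measure coset_process {W \<in> space coset_process. \<forall>p\<in>J. W p (k p) = C p} =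
    1 / real (\<Prod>p\<in>J. p ^ k p) ^ CARD('n)"
proof -
  let ?A = "\<lambda>p. {W \<in> space (coset_chain p). W (k p) = C p}"
  have "{W \<in> space coset_process. \<forall>p\<in>J. W p (k p) = C p} =
      prod_emb {p. prime p} coset_chain J (Pi\<^sub>E J ?A)"
    using J by (auto simp: coset_process_def prod_emb_def space_PiM PiE_iff extensional_def)
  also have "emeasure coset_process \<dots> = (\<Prod>p\<in>J. emeasure (coset_chain p) (?A p))"
    unfolding coset_process_def using assms(1) J
    by (intro emeasure_PiM_emb)
      (auto simp: prime_gt_0_nat coset_chain_props(1) pred_def[symmetric] intro!: pred_coset_chain)
  also have "\<dots> = (\<Prod>p\<in>J. ennreal (1 / real (p ^ k p) ^ CARD('n)))"
    using J C by (intro prod.cong emeasure_coset_chain refl prime_gt_0_nat) auto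
  also have "\<dots> = ennreal (1 / real (\<Prod>p\<in>J. p ^ k p) ^ CARD('n))"
    by (subst prod_ennreal) (auto simp: prod_dividef prod_power_distrib)
  finally show ?thesis
    by (rule measure_eq_emeasure_eq_ennreal[rotated])
      (intro divide_nonneg_nonneg zero_le_power of_nat_0_le_iff zero_le_one)
qed

text \<open>By nestedness, the exponent \<open>V\<^sub>p(x)\<close> is at least \<open>n\<close> exactly when \<open>x \<in> W\<^sub>n\<^sup>p\<close>.\<close>

lemma AE_coset_process_nested:
  "AE W in coset_process. \<forall>p. prime p \<longrightarrow> (\<forall>m. W p (Suc m) \<subseteq> (W p m :: (int ^ 'n) set))"
proof -
  have "AE W in coset_process. prime p \<longrightarrow> (\<forall>m. W p (Suc m) \<subseteq> (W p m :: (int ^ 'n) set))" for p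
  proof (cases "prime p")
    case True
    then show ?thesis unfolding coset_process_def
      using AE_PiM_component[of "{p. prime p}" coset_chain p "\<lambda>W. \<forall>m. W (Suc m) \<subseteq> W m"]
        AE_coset_chain_nested[of p]
      by (simp add: coset_chain_props(1) prime_gt_0_nat)
  qed simp
  then show ?thesis by (simp add: AE_all_countable)
qed

lemma measure_point_in_coset:
  fixes x :: "int ^ 'n"
  assumes "prime p"
  shows "measure coset_process {W \<in> space coset_process. x \<in> W p n} = 1 / real (p ^ n) ^ CARD('n)"
proof -
  have "{W \<in> space coset_process. x \<in> W p n} =
      {W \<in> space coset_process. \<forall>q\<in>{p}. W q n = residue_class (q ^ n) x}"
    using coset_process_in_cosets[OF _ assms] by (auto dest: coset_eq_residue_class)
  then show ?thesis
    using measure_coset_process[of "{p}" "\<lambda>q. residue_class (q ^ n) x" "\<lambda>_. n"] assms by simp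
qed

text \<open>Borel-Cantelli, as \<open>\<Sum>\<^sub>p p\<^bsup>-d\<^esup>\<close> converges for \<open>d \<ge> 2\<close>.\<close>

lemma AE_finitely_many_primes:
  fixes x :: "int ^ 'n"
  assumes "CARD('n) \<ge> 2"
  shows "AE W in coset_process. finite {p. prime p \<and> x \<in> W p 1}"
proof -
  interpret prob_space "coset_process :: (nat \<Rightarrow> nat \<Rightarrow> (int ^ 'n) set) measure"
    by (rule prob_space_coset_process)
  let ?A = "\<lambda>p. {W \<in> space coset_process. prime p \<and> x \<in> W p 1}"
  have "AE W in coset_process. eventually (\<lambda>p. W \<in> space coset_process - ?A p) sequentially"
  proof (rule borel_cantelli_AE1)
    show "?A p \<in> sets coset_process" for p
      using pred_coset_process[of p "\<lambda>D. x \<in> D" 1] by (cases "prime p") (auto simp: pred_def)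
    show "summable (\<lambda>p. measure coset_process (?A p))"
    proof (rule summable_comparison_test'[where N=1])
      show "summable (\<lambda>p. inverse (real p ^ 2))" by (rule inverse_power_summable) simp
      fix p :: nat assume "1 \<le> p"
      then have "1 / real p ^ CARD('n) \<le> inverse (real p ^ 2)"
        using assms by (simp add: inverse_eq_divide divide_left_mono power_increasing)
      then show "norm (measure coset_process (?A p)) \<le> inverse (real p ^ 2)"
        using measure_point_in_coset[of p x 1] by (cases "prime p") auto
    qed
  qed (simp add: emeasure_eq_measure)
  then show ?thesis
  proof eventually_elim
    case (elim W)
    then obtain N where "\<And>p. p \<ge> N \<Longrightarrow> \<not> (prime p \<and> x \<in> W p 1)"
      by (auto simp: eventually_sequentially)
    then have "{p. prime p \<and> x \<in> W p 1} \<subseteq> {..<N}" by (auto simp: not_le[symmetric])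
    then show ?case by (rule finite_subset) simp
  qed
qed

lemma AE_leaves_cosets:
  fixes x :: "int ^ 'n"
  assumes p: "prime p"
  shows "AE W in coset_process. \<exists>n. x \<notin> W p n"
proof -
  interpret prob_space "coset_process :: (nat \<Rightarrow> nat \<Rightarrow> (int ^ 'n) set) measure"
    by (rule prob_space_coset_process)
  note [measurable] = pred_coset_process[OF p]
  let ?A = "{W \<in> space coset_process. \<forall>n. x \<in> W p n}"
  have "measure coset_process ?A \<le> 1 / real (p ^ n) ^ CARD('n)" for n
    unfolding measure_point_in_coset[OF p, of x, symmetric] by (rule finite_measure_mono) auto
  also have "1 / real (p ^ n) ^ CARD('n) \<le> (1 / real p) ^ n" for n
  proof -
    have "real p ^ n \<ge> 1" using prime_gt_0_nat[OF p] by simp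
    then have "real p ^ n \<le> (real p ^ n) ^ CARD('n)" by (intro self_le_power) auto
    then show ?thesis using prime_gt_0_nat[OF p] by (simp add: power_one_over divide_left_mono)
  qed
  finally have "measure coset_process ?A \<le> (1 / real p) ^ n" for n .
  moreover have "(\<lambda>n. (1 / real p) ^ n) \<longlonglongrightarrow> 0"
    using prime_gt_1_nat[OF p] by (intro LIMSEQ_realpow_zero) auto
  ultimately have "measure coset_process ?A \<le> 0"
    by (intro LIMSEQ_le_const) auto
  then have "emeasure coset_process ?A = 0"
    by (simp add: emeasure_eq_measure measure_le_0_iff)
  then show ?thesis by (intro AE_I[of _ _ ?A]) auto
qed

text \<open>The hypotheses hold outside a null set. They make all exponents finite and all but finitely many
  of them zero, so the product is a positive integer. The prime power divisors determine it, and
  they are read off from the cosets.\<close>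

lemma random_gcd_map_power_dvd_iff:
  fixes x :: "int ^ 'n"
  assumes cos: "\<And>p n. prime p \<Longrightarrow> W p n \<in> cosets p n"
    and nested: "\<And>p n. prime p \<Longrightarrow> W p (Suc n) \<subseteq> W p n"
    and leaves: "\<And>p. prime p \<Longrightarrow> \<exists>n. x \<notin> W p n"
    and fin: "finite {p. prime p \<and> x \<in> W p 1}"
  shows "0 < the_enat (random_gcd_map W x)"
    and "prime q \<Longrightarrow> q ^ n dvd the_enat (random_gcd_map W x) \<longleftrightarrow> x \<in> W q n"
proof -
  define v where "v p = the_enat (coset_val (W p) x)" for p
  have v: "coset_val (W p) x = enat (v p)" and v_iff: "x \<in> W p n \<longleftrightarrow> n \<le> v p" if p: "prime p" for p n
  proof -
    have anti: "W p n \<subseteq> W p m" if "m \<le> n" for m n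
      using that nested[OF p] by (rule lift_Suc_antimono_le[rotated])
    have "W p 0 = UNIV" using cos[OF p, of 0] by (auto simp: cosets_eq_residue_classes residue_class_def)
    obtain l where l: "x \<notin> W p l" using leaves[OF p] by blast
    \<comment> \<open>By nestedness \<open>x\<close> lies in \<open>W p n\<close> exactly for \<open>n < k\<close>, and \<open>k > 0\<close> since \<open>W p 0\<close> is everything; so
      the supremum in \<open>coset_val\<close> is \<open>k - 1\<close>.\<close>
    define k where "k = (LEAST l. x \<notin> W p l)"
    have k: "x \<notin> W p k" unfolding k_def using l by (rule LeastI)
    have iff: "x \<in> W p n \<longleftrightarrow> n < k" for n
      using k anti[of k n] not_less_Least[of n "\<lambda>l. x \<notin> W p l"] unfolding k_def by fastforce
    have "k > 0" using \<open>W p 0 = UNIV\<close> k by (cases k) auto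
    have "coset_val (W p) x = enat (k - 1)" unfolding coset_val_def iff
    proof (rule antisym)
      show "(SUP n\<in>{n. n < k}. enat n) \<le> enat (k - 1)" by (rule SUP_least) auto
      show "enat (k - 1) \<le> (SUP n\<in>{n. n < k}. enat n)" using \<open>k > 0\<close> by (intro SUP_upper) auto
    qed
    moreover from this have "v p = k - 1" by (simp add: v_def)
    ultimately show "coset_val (W p) x = enat (v p)" by simp
    from \<open>v p = k - 1\<close> \<open>k > 0\<close> show "x \<in> W p n \<longleftrightarrow> n \<le> v p"
      unfolding iff by linarith
  qed
  define S where "S = {p. prime p \<and> coset_val (W p) x \<noteq> 0}"
  have S: "S = {p. prime p \<and> x \<in> W p 1}" "S = {p. prime p \<and> v p \<noteq> 0}"
    unfolding S_def by (intro Collect_cong conj_cong refl; simp add: v v_iff enat_0_iff Suc_le_eq)+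
  have "prime (2::nat)" by simp
  then have some: "\<not> (\<forall>p. prime p \<longrightarrow> coset_val (W p) x = \<infinity>)" using v by (metis enat.distinct(1))
  have all: "(\<forall>p. prime p \<longrightarrow> coset_val (W p) x \<noteq> \<infinity>) \<and> finite {p. prime p \<and> coset_val (W p) x \<noteq> 0}"
    using v fin S by (simp add: S_def)
  have "finite S" using fin S by simp
  have g: "the_enat (random_gcd_map W x) = (\<Prod>p\<in>S. p ^ v p)"
    unfolding random_gcd_map_def prime_powers_prod_def S_def v_def
    by (subst if_not_P[OF some], subst if_P[OF all], rule the_enat.simps)
  show pos: "0 < the_enat (random_gcd_map W x)" unfolding g
    by (rule prod_pos) (auto simp: S_def prime_gt_0_nat)
  show "q ^ n dvd the_enat (random_gcd_map W x) \<longleftrightarrow> x \<in> W q n" if q: "prime q"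
  proof -
    have "multiplicity q (\<Prod>p\<in>S. p ^ v p) = v q"
      using q \<open>finite S\<close> by (subst multiplicity_prod_prime_powers) (auto simp: S(2))
    moreover have "q ^ n dvd (\<Prod>p\<in>S. p ^ v p) \<longleftrightarrow> n \<le> multiplicity q (\<Prod>p\<in>S. p ^ v p)"
      using q pos g by (intro power_dvd_iff_le_multiplicity) auto
    ultimately show ?thesis using v_iff[OF q] g by simp
  qed
qed

lemma AE_random_gcd_map:
  assumes "CARD('n) \<ge> 2"
  shows "AE W in coset_process. \<forall>x :: int ^ 'n. 0 < the_enat (random_gcd_map W x) \<and>
    (\<forall>p n. prime p \<longrightarrow> (p ^ n dvd the_enat (random_gcd_map W x) \<longleftrightarrow> x \<in> W p n))"
proof -
  have "AE W in coset_process. prime p \<longrightarrow> (\<exists>n. x \<notin> W p n)" for p and x :: "int ^ 'n"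
    using AE_leaves_cosets[of p x] by (cases "prime p") auto
  then have "AE W in coset_process. \<forall>(x :: int ^ 'n) p. prime p \<longrightarrow> (\<exists>n. x \<notin> W p n)"
    by (simp add: AE_all_countable)
  moreover have "AE W in coset_process. \<forall>x :: int ^ 'n. finite {p. prime p \<and> x \<in> W p 1}"
    using AE_finitely_many_primes[OF assms] by (simp add: AE_all_countable)
  ultimately show ?thesis using AE_coset_process_nested AE_space
  proof eventually_elim
    case (elim W)
    have W: "\<And>p n. prime p \<Longrightarrow> W p n \<in> cosets p n" "\<And>p n. prime p \<Longrightarrow> W p (Suc n) \<subseteq> W p n"
      "\<And>p. prime p \<Longrightarrow> \<exists>n. x \<notin> W p n" "finite {p. prime p \<and> x \<in> W p 1}" for x
      using elim coset_process_in_cosets[of W] by blast+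
    show ?case
      by (intro allI conjI impI random_gcd_map_power_dvd_iff[OF W])
  qed
qed

lemma measurable_random_gcd_map:
  "(\<lambda>W x. the_enat (random_gcd_map W x)) \<in>
    measurable (coset_process :: (nat \<Rightarrow> nat \<Rightarrow> (int ^ 'n) set) measure) borel"
proof (rule measurable_coordinatewise_then_product)
  fix x :: "int ^ 'n"
  have "(\<lambda>W. coset_val (W p) x) \<in> measurable coset_process (count_space UNIV)" if p: "prime p" for p
  proof -
    note [measurable] = pred_coset_process[OF p]
    have le: "coset_val (W p) x \<le> enat m \<longleftrightarrow> (\<forall>n. x \<in> W p n \<longrightarrow> n \<le> m)" for W m
      by (auto simp: coset_val_def SUP_le_iff)
    have eq: "u = k \<longleftrightarrow> (\<forall>m. u \<le> enat m \<longleftrightarrow> k \<le> enat m)" for u k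
    proof
      assume *: "\<forall>m. u \<le> enat m \<longleftrightarrow> k \<le> enat m"
      show "u = k"
        using *[rule_format, of "the_enat u"] *[rule_format, of "the_enat k"]
        by (cases u; cases k) auto
    qed simp
    have "Measurable.pred coset_process (\<lambda>W. coset_val (W p) x = k)" for k
      unfolding eq[of _ k] le by measurable
    then show ?thesis
      by (subst measurable_count_space_eq2_countable) (auto simp: pred_def vimage_def Int_def conj_commute)
  qed
  then have "(\<lambda>W. random_gcd_map W x) \<in> measurable coset_process (count_space UNIV)"
    unfolding random_gcd_map_def by (rule measurable_prime_powers_prod)
  then show "(\<lambda>W. the_enat (random_gcd_map W x)) \<in> measurable coset_process borel"
    by (rule measurable_compose) simp
qed

section \<open>Reduction of the random gcd map modulo an integer\<close>

lemma dvd_gcd_map_iff: "m dvd gcd_map z \<longleftrightarrow> (\<forall>i. int m dvd z $ i)"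
proof -
  have "int (gcd_map z) = (GCD i. z $ i)" by (simp add: gcd_map_def)
  then have "m dvd gcd_map z \<longleftrightarrow> int m dvd (GCD i. z $ i)" by (metis int_dvd_int_iff)
  then show ?thesis by (auto simp: dvd_Gcd_iff)
qed

text \<open>Divisibility is tested on prime powers, because these are the divisors that the random cosets
  describe.\<close>

lemma dvd_if_prime_powers_dvd:
  fixes x y :: nat
  assumes "x \<noteq> 0" and "\<And>p n. prime p \<Longrightarrow> p ^ n dvd x \<Longrightarrow> p ^ n dvd y"
  shows "x dvd y"
proof (cases "y = 0")
  case False
  show ?thesis
  proof (rule multiplicity_le_imp_dvd[OF assms(1)])
    fix p :: nat assume p: "prime p"
    have "p ^ multiplicity p x dvd y" by (rule assms(2)[OF p multiplicity_dvd])
    then show "multiplicity p x \<le> multiplicity p y"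
      using p False by (intro multiplicity_geI) auto
  qed
qed simp

text \<open>The event that at every prime power exactly dividing \<open>M\<close> the random coset is that of \<open>u\<close>. By
  the Chinese remainder theorem these cosets have a common residue modulo \<open>M\<close>, and the event says
  that it is \<open>u\<close>.\<close>

definition coset_event :: "nat \<Rightarrow> int ^ 'n \<Rightarrow> (nat \<Rightarrow> nat \<Rightarrow> (int ^ 'n) set) set" where
  "coset_event M u = {W \<in> space coset_process. \<forall>p\<in>prime_factors M.
     W p (multiplicity p M) = residue_class (p ^ multiplicity p M) u}"

lemma sets_coset_event: "coset_event M u \<in> sets coset_process"
  unfolding coset_event_def
  by (intro sets.sets_Collect_finite_All finite_set_mset)
    (auto simp: pred_def[symmetric] intro!: pred_coset_process in_prime_factors_imp_prime)

lemma measure_coset_event: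
  assumes "M > 0"
  shows "measure coset_process (coset_event M (u :: int ^ 'n)) = 1 / real M ^ CARD('n)"
proof -
  have "(\<Prod>p\<in>prime_factors M. p ^ multiplicity p M) = M"
    using assms by (subst prod_prime_factors) auto
  then show ?thesis unfolding coset_event_def
    by (subst measure_coset_process) (auto simp: in_prime_factors_imp_prime)
qed

text \<open>Uniqueness in the Chinese remainder theorem: integers that agree modulo every prime power dividing
  \<open>M\<close> agree modulo \<open>M\<close>.\<close>

lemma disjoint_coset_events:
  assumes "M > 0" shows "disjoint_family_on (coset_event M) (residues M :: (int ^ 'n) set)"
  unfolding disjoint_family_on_def
proof (intro ballI impI, rule ccontr)
  fix u u' :: "int ^ 'n"
  assume u: "u \<in> residues M" "u' \<in> residues M" and "u \<noteq> u'"
  assume "coset_event M u \<inter> coset_event M u' \<noteq> {}"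
  then have eq: "residue_class (p ^ multiplicity p M) u' = residue_class (p ^ multiplicity p M) u"
    if "p \<in> prime_factors M" for p
    using that by (auto simp: coset_event_def)
  have "int M dvd u' $ i - u $ i" for i
  proof -
    have "M dvd nat \<bar>u' $ i - u $ i\<bar>"
    proof (rule dvd_if_prime_powers_dvd)
      fix p n :: nat assume p: "prime p" and n: "p ^ n dvd M"
      show "p ^ n dvd nat \<bar>u' $ i - u $ i\<bar>"
      proof (cases "n = 0")
        case False
        then have "p \<in> prime_factors M"
          using n p assms by (auto simp: prime_factors_dvd intro: dvd_trans[OF dvd_power])
        then have "u' \<in> residue_class (p ^ multiplicity p M) u"
          using eq residue_class_self by blast
        then have "p ^ multiplicity p M dvd nat \<bar>u' $ i - u $ i\<bar>"
          by (simp add: residue_class_def int_dvd_int_iff[symmetric] del: int_dvd_int_iff)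
        moreover have "n \<le> multiplicity p M"
          using n p assms by (intro multiplicity_geI) auto
        ultimately show ?thesis using le_imp_power_dvd dvd_trans by blast
      qed simp
    qed (use assms in simp)
    then show ?thesis by (simp add: nat_dvd_iff int_dvd_int_iff[symmetric] del: int_dvd_int_iff)
  qed
  then have "u' \<in> residue_class M u" by (simp add: residue_class_def)
  with u have "u' = u" by (rule residues_unique)
  with \<open>u \<noteq> u'\<close> show False by simp
qed

text \<open>There are \<open>M\<^sup>d\<close> of these disjoint events, each of probability \<open>M\<^bsup>-d\<^esup>\<close>.\<close>

lemma AE_coset_event:
  assumes "M > 0"
  shows "AE W in coset_process. \<exists>u\<in>residues M :: (int ^ 'n) set. W \<in> coset_event M u"
proof -
  interpret prob_space "coset_process :: (nat \<Rightarrow> nat \<Rightarrow> (int ^ 'n) set) measure"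
    by (rule prob_space_coset_process)
  have "prob (\<Union>u\<in>residues M. coset_event M u) = (\<Sum>u\<in>(residues M :: (int ^ 'n) set). 1 / real M ^ CARD('n))"
    by (subst finite_measure_finite_Union)
      (auto simp: sets_coset_event disjoint_coset_events[OF assms] measure_coset_event[OF assms])
  also have "\<dots> = 1" using assms by (simp add: card_residues)
  finally have "AE W in coset_process. W \<in> (\<Union>u\<in>residues M :: (int ^ 'n) set. coset_event M u)"
    by (rule AE_prob_1)
  then show ?thesis by simp
qed

text \<open>For a prime power \<open>p\<^sup>n\<close> dividing \<open>M\<close> the coset \<open>W p n\<close> contains the coset of \<open>u\<close> at the exact power
  of \<open>p\<close> in \<open>M\<close>; so it is itself the coset of \<open>u\<close>, and it contains \<open>x\<close> iff \<open>p\<^sup>n\<close> divides \<open>x - u\<close>.\<close>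

lemma gcd_random_gcd_map:
  fixes u x :: "int ^ 'n"
  assumes M: "M > 0" and W: "W \<in> coset_event M u"
    and nested: "\<And>p n. prime p \<Longrightarrow> W p (Suc n) \<subseteq> W p n"
    and g: "\<And>p n. prime p \<Longrightarrow> (p ^ n dvd g) = (x \<in> W p n)"
  shows "gcd g M = gcd (gcd_map (x - u)) M"
proof -
  have eq: "p ^ n dvd g \<longleftrightarrow> p ^ n dvd gcd_map (x - u)" if p: "prime p" and n: "p ^ n dvd M" for p n
  proof (cases "n = 0")
    case False
    have pM: "p \<in> prime_factors M"
      using n p M False by (auto simp: prime_factors_dvd intro: dvd_trans[OF dvd_power])
    have "n \<le> multiplicity p M" using n p M by (intro multiplicity_geI) auto
    then have "W p (multiplicity p M) \<subseteq> W p n"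
      using nested[OF p] by (rule lift_Suc_antimono_le[rotated])
    then have "u \<in> W p n" using W pM by (auto simp: coset_event_def)
    then have "W p n = residue_class (p ^ n) u"
      using coset_process_in_cosets[OF _ p, of W] W by (intro coset_eq_residue_class) (auto simp: coset_event_def)
    then show ?thesis unfolding g[OF p] dvd_gcd_map_iff by (simp add: residue_class_def)
  qed simp
  show ?thesis
    by (rule dvd_antisym; rule dvd_if_prime_powers_dvd) (use M eq in auto)
qed

text \<open>The reduction modulo \<open>M\<close> of the random gcd map is the reduction of a translate of the
  deterministic gcd map by a uniform residue.\<close>

proposition mu_inf_gcd_mod:
  fixes A :: "(int ^ 'n) set"
  assumes d: "CARD('n) \<ge> 2" and M: "M > 0" and "finite A"
  shows "measure mu_inf_gcd {\<omega>. \<forall>x\<in>A. gcd (\<omega> x) M = v x} =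
    card {u \<in> residues M. \<forall>x\<in>A. gcd (gcd_map (x - u)) M = v x} / real M ^ CARD('n)"
proof -
  interpret prob_space "coset_process :: (nat \<Rightarrow> nat \<Rightarrow> (int ^ 'n) set) measure"
    by (rule prob_space_coset_process)
  let ?g = "\<lambda>W x. the_enat (random_gcd_map W (x :: int ^ 'n))"
  let ?V = "{\<omega>. \<forall>x\<in>A. gcd (\<omega> x) M = v x}"
  let ?T = "{W \<in> space coset_process. \<forall>x\<in>A. gcd (?g W x) M = v x}"
  let ?R = "{u \<in> residues M. \<forall>x\<in>A. gcd (gcd_map (x - u)) M = v x}"
  have V: "?V \<in> sets borel"
    using assms(3) by (intro borel_open open_finite_coordinates)
  have T: "?T = ?g -` ?V \<inter> space coset_process" by auto
  have "measure mu_inf_gcd ?V = prob ?T"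
    unfolding mu_inf_gcd_def T by (rule measure_distr[OF measurable_random_gcd_map V])
  also have "\<dots> = prob (\<Union>u\<in>?R. coset_event M u)"
  proof (rule finite_measure_eq_AE)
    have "AE W in coset_process. \<exists>u\<in>residues M :: (int ^ 'n) set. W \<in> coset_event M u"
      by (rule AE_coset_event[OF M])
    then show "AE W in coset_process. W \<in> ?T \<longleftrightarrow> W \<in> (\<Union>u\<in>?R. coset_event M u)"
      using AE_random_gcd_map[OF d] AE_coset_process_nested AE_space
    proof eventually_elim
      case (elim W)
      then have eq: "gcd (?g W x) M = gcd (gcd_map (x - u)) M" if "W \<in> coset_event M u" for x u
        using that by (intro gcd_random_gcd_map[OF M]) auto
      from elim obtain u where u: "u \<in> residues M" "W \<in> coset_event M u" by blast
      have same: "gcd (gcd_map (x - u')) M = gcd (gcd_map (x - u)) M" if "W \<in> coset_event M u'" for x u'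
        using eq[OF u(2)] eq[OF that] by metis
      have "W \<in> ?T \<longleftrightarrow> (\<forall>x\<in>A. gcd (gcd_map (x - u)) M = v x)"
        using eq[OF u(2)] elim by simp
      also have "\<dots> \<longleftrightarrow> W \<in> (\<Union>u\<in>?R. coset_event M u)"
      proof
        assume "W \<in> (\<Union>u\<in>?R. coset_event M u)"
        then obtain u' where "\<forall>x\<in>A. gcd (gcd_map (x - u')) M = v x" and "W \<in> coset_event M u'" by blast
        with same[of u'] show "\<forall>x\<in>A. gcd (gcd_map (x - u)) M = v x" by metis
      qed (use u in blast)
      finally show ?case .
    qed
    show "?T \<in> sets coset_process" unfolding T
      by (rule measurable_sets[OF measurable_random_gcd_map V])
    show "(\<Union>u\<in>?R. coset_event M u) \<in> sets coset_process"
      by (intro sets.finite_UN) (auto simp: sets_coset_event)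
  qed
  also have "\<dots> = (\<Sum>u\<in>?R. 1 / real M ^ CARD('n))"
    using disjoint_family_on_mono[OF _ disjoint_coset_events[OF M], of ?R]
    by (subst finite_measure_finite_Union) (auto simp: sets_coset_event measure_coset_event[OF M])
  finally show ?thesis by simp
qed

lemma AE_mu_inf_gcd_pos:
  assumes "CARD('n) \<ge> 2"
  shows "AE \<omega> in mu_inf_gcd. \<forall>x :: int ^ 'n. \<omega> x > 0"
proof -
  have *: "Measurable.pred borel (\<lambda>\<omega> :: int ^ 'n \<Rightarrow> nat. \<omega> x > 0)" for x
    by (rule measurable_compose[OF measurable_product_coordinates]) simp
  then have "Measurable.pred borel (\<lambda>\<omega> :: int ^ 'n \<Rightarrow> nat. \<forall>x. \<omega> x > 0)"
    by (intro pred_intros_countable)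
  then show ?thesis unfolding mu_inf_gcd_def using AE_random_gcd_map[OF assms]
    by (subst AE_distr_iff[OF measurable_random_gcd_map]) (auto simp: pred_def elim: AE_mp)
qed

text \<open>Dominated convergence: almost surely all values are positive, and a positive value is eventually
  unchanged by taking the gcd with \<open>N!\<close>.\<close>

lemma mu_inf_gcd_cylinder_limit:
  fixes A :: "(int ^ 'n) set"
  assumes d: "CARD('n) \<ge> 2" and "finite A"
  shows "(\<lambda>N. measure mu_inf_gcd {\<omega>. \<forall>x\<in>A. gcd (\<omega> x) (fact N) = v x}) \<longlonglongrightarrow>
    measure mu_inf_gcd {\<omega>. \<forall>x\<in>A. \<omega> x = v x}"
proof -
  interpret prob_space "mu_inf_gcd :: (int ^ 'n \<Rightarrow> nat) measure" by (rule prob_space_mu_inf_gcd)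
  have sp: "space (mu_inf_gcd :: (int ^ 'n \<Rightarrow> nat) measure) = UNIV" 
    "sets (mu_inf_gcd :: (int ^ 'n \<Rightarrow> nat) measure) = sets borel"
    by (simp_all add: mu_inf_gcd_def)
  have V: "{\<omega>. \<forall>x\<in>A. h (\<omega> x) = v x} \<in> sets borel" for h :: "nat \<Rightarrow> nat"
    using assms(2) by (intro borel_open open_finite_coordinates)
  let ?V = "\<lambda>h. {\<omega>. \<forall>x\<in>A. h (\<omega> x) = v x}"
  have "(\<lambda>N. integral\<^sup>L mu_inf_gcd (indicator (?V (\<lambda>k. gcd k (fact N))))) \<longlonglongrightarrow>
    (integral\<^sup>L mu_inf_gcd (indicator (?V (\<lambda>k. k))) :: real)"
  proof (rule integral_dominated_convergence[where w="\<lambda>_. 1"])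
    show "AE \<omega> in mu_inf_gcd. (\<lambda>N. indicator (?V (\<lambda>k. gcd k (fact N))) \<omega> :: real) \<longlonglongrightarrow> indicator (?V (\<lambda>k. k)) \<omega>"
      using AE_mu_inf_gcd_pos[OF d]
    proof eventually_elim
      case (elim \<omega>)
      show ?case
      proof (rule tendsto_eventually, rule eventually_sequentiallyI)
        fix N assume N: "Max (insert 0 (\<omega> ` A)) \<le> N"
        have "gcd (\<omega> x) (fact N) = \<omega> x" if "x \<in> A" for x
        proof -
          have "\<omega> x \<le> N" using N that assms(2) by simp
          with elim have "\<omega> x dvd fact N" by (intro dvd_fact) (auto simp: Suc_le_eq)
          then show ?thesis by (simp add: gcd_proj1_iff)
        qed
        then show "indicator (?V (\<lambda>k. gcd k (fact N))) \<omega> = (indicator (?V (\<lambda>k. k)) \<omega> :: real)"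
          by (auto simp: indicator_def)
      qed
    qed
  qed (use V in \<open>auto simp: sp cong: measurable_cong_sets\<close>)
  then show ?thesis using V sp by (simp add: Int_absorb2)
qed

section \<open>Equidistribution in residue classes\<close>

lemma symmetric_interval_iff: "a \<in> {- b..b} \<longleftrightarrow> \<bar>a\<bar> \<le> b" for a b :: int
  by auto

text \<open>Along a line in direction \<open>i\<close> the set is an interval, so \<open>y + e\<^sub>i\<close> leaves it for at most one \<open>y\<close>
  on the line. The count is therefore at most the number of such lines through the box, and a line
  is given by its \<open>d - 1\<close> other coordinates.\<close>

lemma card_line_ends:
  fixes S :: "(int ^ 'n) set"
  assumes box: "\<And>y i. y \<in> S \<Longrightarrow> \<bar>y $ i\<bar> \<le> int L"
    and conv: "\<And>y j k. y \<in> S \<Longrightarrow> y + axis i k \<in> S \<Longrightarrow> 0 \<le> j \<Longrightarrow> j \<le> k \<Longrightarrow> y + axis i j \<in> S"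
  shows "card {y \<in> S. y + axis i 1 \<notin> S} \<le> (2 * L + 1) ^ (CARD('n) - 1)"
proof -
  let ?f = "\<lambda>y :: int ^ 'n. \<chi> j. if j = i then 0 else y $ j"
  let ?I = "\<lambda>j. if j = i then {0} else {- int L..int L}"
  have ends: "y' $ i \<le> y $ i"
    if y: "y \<in> S" "y + axis i 1 \<notin> S" "y' \<in> S" "?f y = ?f y'" for y y'
  proof (rule ccontr)
    assume "\<not> y' $ i \<le> y $ i"
    moreover have "y' = y + axis i (y' $ i - y $ i)"
      using y(4) by (auto simp: vec_eq_iff axis_def split: if_splits)
    ultimately have "y + axis i (y' $ i - y $ i) \<in> S" "1 \<le> y' $ i - y $ i"
      using y(3) by auto
    then have "y + axis i 1 \<in> S" using conv[OF y(1), of "y' $ i - y $ i" 1] by simp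
    with y(2) show False by simp
  qed
  have "inj_on ?f {y \<in> S. y + axis i 1 \<notin> S}"
  proof (rule inj_onI)
    fix y y' assume y: "y \<in> {y \<in> S. y + axis i 1 \<notin> S}" "y' \<in> {y \<in> S. y + axis i 1 \<notin> S}" "?f y = ?f y'"
    then have "y $ i = y' $ i" using ends[of y y'] ends[of y' y] by simp
    with y(3) show "y = y'" by (auto simp: vec_eq_iff split: if_splits)
  qed
  then have "card {y \<in> S. y + axis i 1 \<notin> S} \<le> card {y :: int ^ 'n. \<forall>j. y $ j \<in> ?I j}"
  proof (rule card_inj_on_le)
    show "?f ` {y \<in> S. y + axis i 1 \<notin> S} \<subseteq> {y. \<forall>j. y $ j \<in> ?I j}"
      using box by (auto simp: symmetric_interval_iff simp del: atLeastAtMost_iff)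
    show "finite {y :: int ^ 'n. \<forall>j. y $ j \<in> ?I j}" by (rule finite_int_box) simp
  qed
  also have "\<dots> = (\<Prod>j\<in>UNIV. if j = i then 1 else 2 * L + 1)"
    by (subst card_int_box) (auto intro!: prod.cong)
  also have "\<dots> = (2 * L + 1) ^ (CARD('n) - 1)"
    by (simp add: prod.If_cases card_Diff_singleton Compl_eq_Diff_UNIV)
  finally show ?thesis .
qed

text \<open>Translation by \<open>e\<^sub>i\<close> maps one residue class into the other, apart from the ends of lines.\<close>

lemma card_residue_class_step:
  fixes S :: "(int ^ 'n) set"
  assumes "finite S" and B: "card {y \<in> S. y + axis i 1 \<notin> S} \<le> B"
  shows "card (S \<inter> residue_class M a) \<le> card (S \<inter> residue_class M (a + axis i 1)) + B"
proof -
  let ?E = "{y \<in> S. y + axis i 1 \<notin> S}"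
  have "card (S \<inter> residue_class M a - ?E) \<le> card (S \<inter> residue_class M (a + axis i 1))"
  proof (rule card_inj_on_le[where f="\<lambda>y. y + axis i 1"])
    show "(\<lambda>y. y + axis i 1) ` (S \<inter> residue_class M a - ?E) \<subseteq> S \<inter> residue_class M (a + axis i 1)"
      by (auto simp: residue_class_def)
  qed (use assms in auto)
  moreover have "card (S \<inter> residue_class M a) - card ?E \<le> card (S \<inter> residue_class M a - ?E)"
    using assms(1) by (intro diff_card_le_card_Diff) auto
  ultimately show ?thesis using B by linarith
qed

lemma card_residue_class_shift:
  fixes S :: "(int ^ 'n) set"
  assumes "finite S" and B: "\<And>i. card {y \<in> S. y + axis i 1 \<notin> S} \<le> B"
    and "\<And>i. 0 \<le> c $ i"
  shows "card (S \<inter> residue_class M a) \<le>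
    card (S \<inter> residue_class M (a + c)) + nat (\<Sum>i\<in>UNIV. c $ i) * B"
  using assms(3)
proof (induction "nat (\<Sum>i\<in>UNIV. c $ i)" arbitrary: c)
  case 0
  then have "(\<Sum>i\<in>UNIV. c $ i) = 0" by (intro antisym sum_nonneg) auto
  then have "c = 0" using 0 by (simp add: sum_nonneg_eq_0_iff vec_eq_iff)
  then show ?case by simp
next
  case (Suc k)
  have "\<exists>i. c $ i > 0"
  proof (rule ccontr)
    assume "\<not> (\<exists>i. c $ i > 0)"
    then have "(\<Sum>i\<in>UNIV. c $ i) \<le> 0" by (intro sum_nonpos) (auto simp: not_less)
    with Suc.hyps(2) show False by simp
  qed
  then obtain i where i: "c $ i > 0" by blast
  define c' where "c' = c - axis i 1"
  have c': "0 \<le> c' $ j" for j using i Suc.prems[of j] by (auto simp: c'_def axis_def)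
  have "(\<Sum>j\<in>UNIV. c $ j) = (\<Sum>j\<in>UNIV. c' $ j + (if j = i then 1 else 0))"
    by (intro sum.cong) (auto simp: c'_def axis_def)
  also have "\<dots> = (\<Sum>j\<in>UNIV. c' $ j) + 1" by (simp add: sum.distrib)
  finally have k: "k = nat (\<Sum>j\<in>UNIV. c' $ j)" using Suc.hyps(2) by simp
  have "card (S \<inter> residue_class M a) \<le> card (S \<inter> residue_class M (a + c')) + k * B"
    unfolding k by (rule Suc.hyps(1)[OF k c'])
  also have "card (S \<inter> residue_class M (a + c')) \<le> card (S \<inter> residue_class M (a + c' + axis i 1)) + B"
    by (rule card_residue_class_step[OF assms(1) B])
  also have "a + c' + axis i 1 = a + c" by (simp add: c'_def)
  finally show ?case unfolding Suc.hyps(2)[symmetric] by simp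
qed

text \<open>Some \<open>c\<close> with coordinates in \<open>{0..<M}\<close> translates the class of \<open>a\<close> to that of \<open>b\<close>; it is a sum of
  fewer than \<open>d M\<close> unit vectors. As \<open>a\<close> and \<open>b\<close> are arbitrary, the bound holds in both directions.\<close>

lemma card_residue_class_compare:
  fixes S :: "(int ^ 'n) set"
  assumes "finite S" and B: "\<And>i. card {y \<in> S. y + axis i 1 \<notin> S} \<le> B" and M: "M > 0"
  shows "card (S \<inter> residue_class M a) \<le> card (S \<inter> residue_class M b) + CARD('n) * M * B"
proof -
  define c where "c = (\<chi> i. (b $ i - a $ i) mod int M)"
  have "b \<in> residue_class M (a + c)"
    using M by (simp add: residue_class_def c_def mod_eq_dvd_iff[symmetric] mod_simps)
  then have "residue_class M (a + c) = residue_class M b" by (simp add: residue_class_cong)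
  moreover have "(\<Sum>i\<in>UNIV. c $ i) \<le> (\<Sum>i\<in>(UNIV :: 'n set). int M)"
    using M by (intro sum_mono) (simp add: c_def less_imp_le)
  then have "nat (\<Sum>i\<in>UNIV. c $ i) \<le> CARD('n) * M" by (simp add: nat_le_iff)
  then have "nat (\<Sum>i\<in>UNIV. c $ i) * B \<le> CARD('n) * M * B" by (rule mult_right_mono) simp
  moreover have "card (S \<inter> residue_class M a) \<le>
      card (S \<inter> residue_class M (a + c)) + nat (\<Sum>i\<in>UNIV. c $ i) * B"
    using M by (intro card_residue_class_shift assms) (simp add: c_def)
  ultimately show ?thesis by presburger
qed

lemma card_eq_sum_residue_classes:
  fixes S :: "(int ^ 'n) set"
  assumes "finite S" "M > 0"
  shows "card S = (\<Sum>u\<in>residues M. card (S \<inter> residue_class M u))"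
proof -
  have "S = (\<Union>u\<in>residues M. S \<inter> residue_class M u)"
    using residues_exists[OF assms(2)] by auto
  then have "card S = card (\<Union>u\<in>residues M. S \<inter> residue_class M u)" by (rule arg_cong)
  also have "\<dots> = (\<Sum>u\<in>residues M. card (S \<inter> residue_class M u))"
  proof (rule card_UN_disjoint)
    show "\<forall>u\<in>residues M. \<forall>u'\<in>residues M. u \<noteq> u' \<longrightarrow>
      (S \<inter> residue_class M u) \<inter> (S \<inter> residue_class M u') = {}"
    proof (intro ballI impI, rule ccontr)
      fix u u' :: "int ^ 'n"
      assume u: "u \<in> residues M" "u' \<in> residues M" "u \<noteq> u'"
        and "(S \<inter> residue_class M u) \<inter> (S \<inter> residue_class M u') \<noteq> {}"
      then obtain y where "y \<in> residue_class M u" "y \<in> residue_class M u'" by blast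
      then have "residue_class M u = residue_class M u'" by (metis residue_class_cong)
      then have "u' \<in> residue_class M u" by simp
      with u show False using residues_unique by blast
    qed
  qed (use assms in auto)
  finally show ?thesis .
qed

text \<open>All \<open>M\<^sup>d\<close> classes have the same number of points up to a common error, and they add up to \<open>S\<close>.\<close>

lemma residue_class_density:
  fixes S :: "(int ^ 'n) set"
  assumes "finite S" "S \<noteq> {}" and B: "\<And>i. card {y \<in> S. y + axis i 1 \<notin> S} \<le> B" and M: "M > 0"
  shows "\<bar>real (card (S \<inter> residue_class M a)) / real (card S) - 1 / real M ^ CARD('n)\<bar> \<le>
    real (CARD('n) * M * B) / real (card S)"
proof -
  define t where "t u = real (card (S \<inter> residue_class M u))" for u
  define E where "E = real (CARD('n) * M * B)"
  define q where "q = real M ^ CARD('n)"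
  have q: "q > 0" using M by (simp add: q_def)
  have s: "real (card S) > 0" using assms(1,2) by (simp add: card_gt_0_iff)
  have cmp: "t u \<le> t v + E" for u v
    using card_residue_class_compare[OF assms(1) B M, of u v] unfolding t_def E_def
    by (metis of_nat_add of_nat_le_iff)
  have sum: "real (card S) = (\<Sum>u\<in>residues M. t u)"
    unfolding t_def by (subst card_eq_sum_residue_classes[OF assms(1) M]) simp
  have "real (card S) \<le> (\<Sum>u\<in>(residues M :: (int ^ 'n) set). t a + E)"
    unfolding sum using cmp by (intro sum_mono)
  moreover have "(\<Sum>u\<in>(residues M :: (int ^ 'n) set). t a - E) \<le> real (card S)"
    unfolding sum using cmp by (intro sum_mono) (simp add: algebra_simps)
  ultimately have "real (card S) / q \<le> t a + E" "t a - E \<le> real (card S) / q"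
    using q by (simp_all add: card_residues q_def field_simps)
  then have "\<bar>t a - real (card S) / q\<bar> \<le> E" by linarith
  then have "\<bar>t a - real (card S) / q\<bar> / real (card S) \<le> E / real (card S)"
    using s by (intro divide_right_mono) auto
  moreover have "\<bar>t a - real (card S) / q\<bar> / real (card S) = \<bar>t a / real (card S) - 1 / q\<bar>"
    using s q by (simp add: abs_div_pos diff_divide_distrib)
  ultimately show ?thesis by (simp add: t_def E_def q_def)
qed

section \<open>Points of a box with a large greatest common divisor\<close>

lemma gcd_map_eq_0_iff: "gcd_map z = 0 \<longleftrightarrow> z = 0"
  using dvd_gcd_map_iff[of 0 z] by (simp add: vec_eq_iff)

lemma sum_inverse_squares_le:
  assumes "0 < N" "N \<le> H"
  shows "(\<Sum>q\<in>{N<..H}. 1 / real q ^ 2) \<le> 1 / real N - 1 / real H"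
  using assms(2)
proof (induction H rule: dec_induct)
  case (step H)
  have H: "real H > 0" using step assms(1) by linarith
  then have "1 / real (Suc H) ^ 2 \<le> 1 / (real H * real (Suc H))"
    by (intro divide_left_mono) (auto simp: power2_eq_square intro!: mult_right_mono)
  also have "\<dots> = 1 / real H - 1 / real (Suc H)" using H by (simp add: field_simps)
  finally have "1 / real (Suc H) ^ 2 \<le> 1 / real H - 1 / real (Suc H)" .
  moreover have "{N<..Suc H} = insert (Suc H) {N<..H}" using step by auto
  ultimately show ?case using step by simp
qed simp

text \<open>A nonzero point of the box with gcd \<open>q\<close> is \<open>q\<close> times a point of the box of radius \<open>H div q\<close>.
  This is the place where \<open>d \<ge> 2\<close> makes the sum over \<open>q > N\<close> small. The summand \<open>1\<close> accounts for
  the origin, the only point with gcd \<open>0\<close>.\<close>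

lemma card_large_gcd:
  fixes N H :: nat
  assumes d: "CARD('n) \<ge> 2" and N: "N > 0"
  shows "real (card {z :: int ^ 'n. (\<forall>i. \<bar>z $ i\<bar> \<le> int H) \<and> (gcd_map z = 0 \<or> gcd_map z > N)})
    \<le> 1 + (3 * real H) ^ CARD('n) / real N"
proof -
  let ?Z = "{z :: int ^ 'n. (\<forall>i. \<bar>z $ i\<bar> \<le> int H) \<and> (gcd_map z = 0 \<or> gcd_map z > N)}"
  let ?W = "\<lambda>q. {w :: int ^ 'n. \<forall>i. w $ i \<in> {- int (H div q)..int (H div q)}}"
  let ?D = "\<lambda>q. (\<lambda>w. int q *s w) ` ?W q"
  have fin: "finite (?W q)" for q by (rule finite_int_box) simp
  have card_D: "real (card (?D q)) \<le> (3 * real H) ^ CARD('n) * (1 / real q ^ 2)"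
    if q: "q \<in> {N<..H}" for q
  proof -
    have "card (?D q) \<le> card (?W q)" by (rule card_image_le[OF fin])
    also have "\<dots> = (2 * (H div q) + 1) ^ CARD('n)"
      by (subst card_int_box) (simp_all add: nat_add_distrib nat_mult_distrib)
    finally have "real (card (?D q)) \<le> real ((2 * (H div q) + 1) ^ CARD('n))"
      by (simp only: of_nat_le_iff)
    also have "\<dots> = (2 * real (H div q) + 1) ^ CARD('n)" by (simp add: add.commute)
    also have "\<dots> \<le> (3 * real H / real q) ^ CARD('n)"
    proof (rule power_mono)
      \<comment> \<open>\<open>q \<le> H\<close> absorbs the additive constant.\<close>
      have "real (H div q) \<le> real H / real q" by (rule of_nat_div_le_of_nat)
      moreover have "1 \<le> real H / real q" using q by simp
      ultimately show "2 * real (H div q) + 1 \<le> 3 * real H / real q" by simp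
    qed simp
    also have "\<dots> = (3 * real H) ^ CARD('n) * (1 / real q ^ CARD('n))"
      by (simp add: power_divide)
    also have "\<dots> \<le> (3 * real H) ^ CARD('n) * (1 / real q ^ 2)"
    proof (rule mult_left_mono)
      show "1 / real q ^ CARD('n) \<le> 1 / real q ^ 2"
        using d q by (intro divide_left_mono power_increasing) auto
    qed simp
    finally show ?thesis .
  qed
  have "?Z \<subseteq> {0} \<union> (\<Union>q\<in>{N<..H}. ?D q)"
  proof
    fix z assume z: "z \<in> ?Z"
    show "z \<in> {0} \<union> (\<Union>q\<in>{N<..H}. ?D q)"
    proof (cases "z = 0")
      case False
      define q where "q = gcd_map z"
      have "q > N" using z False by (auto simp: q_def gcd_map_eq_0_iff)
      have dvd: "int q dvd z $ i" for i using dvd_gcd_map_iff[of q z] by (simp add: q_def)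
      obtain i where "z $ i \<noteq> 0" using False by (auto simp: vec_eq_iff)
      then have "\<bar>int q\<bar> \<le> \<bar>z $ i\<bar>" using dvd by (rule dvd_imp_le_int)
      also have "\<bar>z $ i\<bar> \<le> int H" using z by blast
      finally have "q \<le> H" by simp
      define w where "w = (\<chi> i. z $ i div int q)"
      have zw: "z = int q *s w" using dvd by (simp add: vec_eq_iff w_def)
      have "\<bar>w $ i\<bar> \<le> int (H div q)" for i
      proof -
        have "\<bar>z $ i\<bar> = \<bar>w $ i\<bar> * int q" unfolding zw by (simp add: abs_mult)
        moreover have "\<bar>z $ i\<bar> \<le> int H" using z by blast
        ultimately have "int (nat \<bar>w $ i\<bar> * q) \<le> int H" by simp
        then have "nat \<bar>w $ i\<bar> * q \<le> H" by (simp only: of_nat_le_iff)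
        then have "nat \<bar>w $ i\<bar> \<le> H div q"
          using \<open>q > N\<close> by (simp add: less_eq_div_iff_mult_less_eq)
        then show ?thesis by (simp add: nat_le_iff)
      qed
      then have "w \<in> ?W q" by (auto simp: symmetric_interval_iff simp del: atLeastAtMost_iff)
      with zw \<open>q > N\<close> \<open>q \<le> H\<close> show ?thesis by auto
    qed simp
  qed
  then have "card ?Z \<le> card ({0} \<union> (\<Union>q\<in>{N<..H}. ?D q))"
    using fin by (intro card_mono) auto
  also have "\<dots> \<le> 1 + card (\<Union>q\<in>{N<..H}. ?D q)" using card_Un_le[of "{0}"] by simp
  also have "\<dots> \<le> 1 + (\<Sum>q\<in>{N<..H}. card (?D q))" using card_UN_le[of "{N<..H}" ?D] by simp
  finally have "real (card ?Z) \<le> real (1 + (\<Sum>q\<in>{N<..H}. card (?D q)))"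
    by (simp only: of_nat_le_iff)
  also have "\<dots> = 1 + (\<Sum>q\<in>{N<..H}. real (card (?D q)))" by simp
  finally have Z: "real (card ?Z) \<le> 1 + (\<Sum>q\<in>{N<..H}. real (card (?D q)))" .
  have "(\<Sum>q\<in>{N<..H}. real (card (?D q))) \<le> (\<Sum>q\<in>{N<..H}. (3 * real H) ^ CARD('n) * (1 / real q ^ 2))"
    by (rule sum_mono[OF card_D])
  also have "\<dots> = (3 * real H) ^ CARD('n) * (\<Sum>q\<in>{N<..H}. 1 / real q ^ 2)"
    by (simp add: sum_distrib_left)
  also have "\<dots> \<le> (3 * real H) ^ CARD('n) * (1 / real N)"
  proof (rule mult_left_mono)
    show "(\<Sum>q\<in>{N<..H}. 1 / real q ^ 2) \<le> 1 / real N"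
    proof (cases "N \<le> H")
      case True
      then show ?thesis using sum_inverse_squares_le[OF N True] N
        by (smt (verit) divide_nonneg_nonneg of_nat_0_le_iff)
    qed simp
  qed simp
  finally have "(\<Sum>q\<in>{N<..H}. real (card (?D q))) \<le> (3 * real H) ^ CARD('n) / real N"
    by (simp only: times_divide_eq_right mult_1_right)
  with Z show ?thesis by (rule order_trans[OF _ add_left_mono])
qed

section \<open>Lattice points of a dilated convex set\<close>

lemma mem_lattice_points:
  "r > 0 \<Longrightarrow> y \<in> lattice_points F r \<longleftrightarrow> (\<chi> i. real_of_int (y $ i) / r) \<in> F"
  by (simp add: lattice_points_def scaleR_vec_def divide_inverse mult.commute)

text \<open>\<open>y + j e\<^sub>i\<close> is the convex combination of \<open>y\<close> and \<open>y + k e\<^sub>i\<close> with weight \<open>j / k\<close>.\<close>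

lemma lattice_points_line_convex:
  fixes F :: "(real ^ 'n) set"
  assumes "convex F" "r > 0"
    and y: "y \<in> lattice_points F r" "y + axis i k \<in> lattice_points F r" and j: "0 \<le> j" "j \<le> k"
  shows "y + axis i j \<in> lattice_points F r"
proof (cases "k = 0")
  case False
  then have k: "k > 0" using j by simp
  let ?v = "\<lambda>y :: int ^ 'n. \<chi> i. real_of_int (y $ i) / r"
  define t where "t = real_of_int j / real_of_int k"
  have t: "0 \<le> t" "t \<le> 1" using j k by (auto simp: t_def)
  have tk: "t * real_of_int k = real_of_int j" using k by (simp add: t_def)
  have "(1 - t) *\<^sub>R ?v y + t *\<^sub>R ?v (y + axis i k) \<in> F"
    using y t assms(1,2) by (intro convexD_alt) (auto simp: mem_lattice_points)
  also have "(1 - t) *\<^sub>R ?v y + t *\<^sub>R ?v (y + axis i k) = ?v (y + axis i j)"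
  proof -
    have "(1 - t) * (a / r) + t * ((a + real_of_int k) / r) = (a + real_of_int j) / r" for a
      unfolding tk[symmetric] using assms(2) by (simp add: field_simps)
    moreover have "(1 - t) * (a / r) + t * (a / r) = a / r" for a
      using assms(2) by (simp add: field_simps)
    ultimately show ?thesis by (auto simp: vec_eq_iff axis_def)
  qed
  finally show ?thesis using assms(2) by (simp add: mem_lattice_points)
qed (use y j in simp)

lemma lattice_points_box:
  fixes F :: "(real ^ 'n) set"
  assumes "r > 0" and R: "\<forall>z\<in>F. norm z \<le> R" and y: "y \<in> lattice_points F r"
  shows "\<bar>y $ i\<bar> \<le> int (nat \<lceil>R * r\<rceil>)"
proof -
  let ?v = "\<chi> i. real_of_int (y $ i) / r"
  have "\<bar>?v $ i\<bar> \<le> R" using component_le_norm_cart[of ?v i] R y assms(1)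
    by (force simp: mem_lattice_points)
  then have "real_of_int \<bar>y $ i\<bar> \<le> R * r" using assms(1) by (simp add: field_simps)
  then show ?thesis by linarith
qed

lemma finite_lattice_points:
  fixes F :: "(real ^ 'n) set"
  assumes "r > 0" and R: "\<forall>z\<in>F. norm z \<le> R"
  shows "finite (lattice_points F r)"
proof (rule finite_subset)
  let ?L = "int (nat \<lceil>R * r\<rceil>)"
  show "lattice_points F r \<subseteq> {y. \<forall>i. y $ i \<in> {- ?L..?L}}"
    unfolding symmetric_interval_iff using lattice_points_box[OF assms] by blast
  show "finite {y :: int ^ 'n. \<forall>i. y $ i \<in> {- ?L..?L}}" by (rule finite_int_box) simp
qed

text \<open>\<open>F\<close> contains a cube of half side \<open>s\<close>, whose dilation by \<open>r\<close> contains a discrete cube of side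
  \<open>\<lfloor>r s\<rfloor>\<close>.\<close>

lemma card_lattice_points_ge:
  fixes F :: "(real ^ 'n) set"
  assumes "bounded F" and "interior F \<noteq> {}"
  shows "\<exists>c>0. eventually (\<lambda>r. c * r ^ CARD('n) \<le> real (card (lattice_points F r))) at_top"
proof -
  obtain R where R: "\<forall>z\<in>F. norm z \<le> R" using assms(1) by (auto simp: bounded_iff)
  obtain z where "z \<in> interior F" using assms(2) by blast
  then obtain e where e: "e > 0" "ball z e \<subseteq> F" using mem_interior by blast
  \<comment> \<open>By comparison with the sum norm, a cube of half side less than \<open>e / d\<close> lies in the ball of
    radius \<open>e\<close>.\<close>
  define s where "s = e / (2 * real CARD('n))"
  have s: "s > 0" using e by (simp add: s_def)
  have in_F: "v \<in> F" if "\<And>i. \<bar>v $ i - z $ i\<bar> \<le> s" for v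
  proof -
    have "norm (v - z) \<le> (\<Sum>i\<in>UNIV. \<bar>(v - z) $ i\<bar>)" by (rule norm_le_l1_cart)
    also have "\<dots> \<le> (\<Sum>i\<in>(UNIV :: 'n set). s)" using that by (intro sum_mono) simp
    also have "\<dots> < e" using e by (simp add: s_def)
    finally show ?thesis using e(2) by (auto simp: dist_norm norm_minus_commute)
  qed
  have "(s / 2) ^ CARD('n) * r ^ CARD('n) \<le> real (card (lattice_points F r))" if r: "r \<ge> 2 / s" for r
  proof -
    have rs: "r * s \<ge> 2" using r s by (simp add: field_simps)
    have r0: "r > 0" using r s by (meson divide_pos_pos less_le_trans zero_less_numeral)
    \<comment> \<open>The discrete cube starts at the lower corner, rounded up, and reaches at most up to the
      centre of the dilated cube. Its side satisfies \<open>\<lfloor>r s\<rfloor> \<ge> r s / 2\<close>, as \<open>r s \<ge> 2\<close>.\<close>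
    define k where "k = nat \<lfloor>r * s\<rfloor>"
    define l where "l i = \<lceil>r * (z $ i - s)\<rceil>" for i
    let ?B = "{y :: int ^ 'n. \<forall>i. y $ i \<in> {l i..<l i + int k}}"
    have "?B \<subseteq> lattice_points F r"
    proof
      fix y assume y: "y \<in> ?B"
      have "\<bar>real_of_int (y $ i) / r - z $ i\<bar> \<le> s" for i
      proof -
        have "l i \<le> y $ i" "y $ i < l i + int k" using y by auto
        moreover have "int k = \<lfloor>r * s\<rfloor>" using rs by (simp add: k_def)
        ultimately have "r * (z $ i - s) \<le> real_of_int (y $ i)" "real_of_int (y $ i) \<le> r * (z $ i - s) + r * s"
          unfolding l_def by linarith+
        then have "r * (z $ i - s) \<le> real_of_int (y $ i)" "real_of_int (y $ i) \<le> r * (z $ i + s)"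
          using mult_pos_pos[OF r0 s] by (auto simp: algebra_simps)
        then have "z $ i - s \<le> real_of_int (y $ i) / r" "real_of_int (y $ i) / r \<le> z $ i + s"
          using r0 by (simp_all add: field_simps)
        then show ?thesis by linarith
      qed
      then show "y \<in> lattice_points F r" using in_F r0 by (simp add: mem_lattice_points)
    qed
    then have "card ?B \<le> card (lattice_points F r)"
      by (rule card_mono[OF finite_lattice_points[OF r0 R]])
    moreover have "card ?B = k ^ CARD('n)" by (subst card_int_box) simp_all
    ultimately have "real k ^ CARD('n) \<le> real (card (lattice_points F r))"
      by (metis of_nat_le_iff of_nat_power)
    moreover have "s / 2 * r \<le> real k" using rs unfolding k_def by (simp add: mult.commute) linarith
    then have "(s / 2 * r) ^ CARD('n) \<le> real k ^ CARD('n)"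
      using s r0 by (intro power_mono) auto
    ultimately show ?thesis by (simp only: power_mult_distrib)
  qed
  then have "eventually (\<lambda>r. (s / 2) ^ CARD('n) * r ^ CARD('n) \<le> real (card (lattice_points F r))) at_top"
    unfolding eventually_at_top_linorder by blast
  then show ?thesis using s by (intro exI[of _ "(s / 2) ^ CARD('n)"]) auto
qed

text \<open>The difference to the limit is at most a multiple of \<open>r\<^bsup>d-1\<^esup> / r\<^sup>d\<close>.\<close>

proposition lattice_points_equidistributed:
  fixes F :: "(real ^ 'n) set"
  assumes F: "bounded F" "convex F" "interior F \<noteq> {}" and M: "M > 0"
  shows "((\<lambda>r. real (card (lattice_points F r \<inter> residue_class M a)) / real (card (lattice_points F r)))
    \<longlongrightarrow> 1 / real M ^ CARD('n)) at_top"
proof -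
  obtain R where R: "\<forall>z\<in>F. norm z \<le> R" and R0: "R > 0"
    using F(1) bounded_pos by blast
  obtain c where c: "c > 0" and
    card_ge: "eventually (\<lambda>r. c * r ^ CARD('n) \<le> real (card (lattice_points F r))) at_top"
    using card_lattice_points_ge[OF F(1,3)] by blast
  define D where "D = CARD('n) - 1"
  have D: "CARD('n) = Suc D" by (simp add: D_def)
  define K where "K = real (CARD('n) * M) * (2 * R + 3) ^ D / c"
  have "((\<lambda>r. real (card (lattice_points F r \<inter> residue_class M a)) / real (card (lattice_points F r))
      - 1 / real M ^ CARD('n)) \<longlongrightarrow> 0) at_top"
  proof (rule tendsto_0_le)
    show "((\<lambda>r. K / r) \<longlongrightarrow> 0) at_top"
      by (intro tendsto_divide_0[OF tendsto_const] filterlim_at_top_imp_at_infinity filterlim_ident)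
    show "eventually (\<lambda>r. norm (real (card (lattice_points F r \<inter> residue_class M a)) /
        real (card (lattice_points F r)) - 1 / real M ^ CARD('n)) \<le> norm (K / r) * 1) at_top"
      using card_ge eventually_ge_at_top[of 1]
    proof eventually_elim
      case (elim r)
      then have r: "r > 0" by simp
      let ?S = "lattice_points F r"
      define L where "L = nat \<lceil>R * r\<rceil>"
      define B where "B = (2 * L + 1) ^ D"
      have "c * r ^ CARD('n) > 0" using c r by simp
      then have S0: "real (card ?S) > 0" using elim(1) by linarith
      then have S: "?S \<noteq> {}" by auto
      have "card {y \<in> ?S. y + axis i 1 \<notin> ?S} \<le> B" for i
        unfolding B_def D_def L_def
        by (rule card_line_ends[OF lattice_points_box[OF r R] lattice_points_line_convex[OF F(2) r]])
      from residue_class_density[OF finite_lattice_points[OF r R] S this M, of a]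
      have "norm (real (card (?S \<inter> residue_class M a)) / real (card ?S) - 1 / real M ^ CARD('n)) \<le>
          real (CARD('n) * M * B) / real (card ?S)" by simp
      also have "\<dots> \<le> real (CARD('n) * M * B) / (c * r ^ CARD('n))"
        using elim(1) S0 c r by (intro divide_left_mono mult_pos_pos) auto
      also have "\<dots> \<le> real (CARD('n) * M) * ((2 * R + 3) * r) ^ D / (c * r ^ CARD('n))"
      proof -
        have "real L \<le> R * r + 1" using R0 r unfolding L_def by (simp add: of_nat_nat)
        then have "real (2 * L + 1) \<le> (2 * R + 3) * r" using elim by (simp add: algebra_simps)
        then have "real B \<le> ((2 * R + 3) * r) ^ D" unfolding B_def of_nat_power by (intro power_mono) auto
        then have "real (CARD('n) * M) * real B \<le> real (CARD('n) * M) * ((2 * R + 3) * r) ^ D"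
          by (intro mult_left_mono) auto
        then show ?thesis using c r by (intro divide_right_mono) simp_all
      qed
      also have "\<dots> = K / r" unfolding K_def D power_mult_distrib using c r by (simp add: field_simps)
      also have "K / r \<le> norm (K / r) * 1" by (simp only: real_norm_def mult_1_right abs_ge_self)
      finally show ?case .
    qed
  qed
  then show ?thesis by (simp only: LIM_zero_iff)
qed

text \<open>The constant depends neither on \<open>x\<close> nor on \<open>N\<close>: the translates of \<open>F\<^sub>r\<close> by \<open>x\<close> lie in a box of side
  comparable to \<open>r\<close> once \<open>r\<close> is large compared to \<open>x\<close>, and the contribution of the origin is at
  most \<open>r\<^sup>d / N\<close> once \<open>r \<ge> N\<close>.\<close>

proposition lattice_points_large_gcd:
  fixes F :: "(real ^ 'n) set"
  assumes d: "CARD('n) \<ge> 2" and F: "bounded F" "interior F \<noteq> {}"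
  shows "\<exists>K. \<forall>(x :: int ^ 'n) N. N > 0 \<longrightarrow> eventually (\<lambda>r.
    real (card {y \<in> lattice_points F r. gcd_map (x + y) = 0 \<or> gcd_map (x + y) > N}) /
    real (card (lattice_points F r)) \<le> K / real N) at_top"
proof -
  obtain R where R: "\<forall>z\<in>F. norm z \<le> R" and R0: "R > 0"
    using F(1) bounded_pos by blast
  obtain c where c: "c > 0" and
    card_ge: "eventually (\<lambda>r. c * r ^ CARD('n) \<le> real (card (lattice_points F r))) at_top"
    using card_lattice_points_ge[OF F] by blast
  define K where "K = (1 + (3 * (R + 1)) ^ CARD('n)) / c"
  have "eventually (\<lambda>r. real (card {y \<in> lattice_points F r. gcd_map (x + y) = 0 \<or> gcd_map (x + y) > N}) /
    real (card (lattice_points F r)) \<le> K / real N) at_top" if N: "N > 0" for x :: "int ^ 'n" and N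
  proof -
    define X where "X = (\<Sum>i\<in>UNIV. nat \<bar>x $ i\<bar>)"
    have X: "\<bar>x $ i\<bar> \<le> int X" for i
    proof -
      have "nat \<bar>x $ i\<bar> \<le> X" unfolding X_def by (rule member_le_sum) auto
      then show ?thesis by (simp add: nat_le_iff)
    qed
    show ?thesis
      using card_ge eventually_ge_at_top[of "real X + 1"] eventually_ge_at_top[of "real N"]
    proof eventually_elim
      case (elim r)
      then have r: "r \<ge> 1" "r > 0" by auto
      let ?S = "lattice_points F r"
      define H where "H = nat \<lceil>R * r\<rceil> + X"
      have "real (nat \<lceil>R * r\<rceil>) \<le> R * r + 1" using R0 r by (simp add: of_nat_nat)
      then have H: "real H \<le> (R + 1) * r" using elim by (simp add: H_def algebra_simps)
      let ?E = "{y \<in> ?S. gcd_map (x + y) = 0 \<or> gcd_map (x + y) > N}"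
      let ?Z = "{z :: int ^ 'n. (\<forall>i. \<bar>z $ i\<bar> \<le> int H) \<and> (gcd_map z = 0 \<or> gcd_map z > N)}"
      have "card ?E \<le> card ?Z"
      proof (rule card_inj_on_le[where f="\<lambda>y. x + y"])
        show "(\<lambda>y. x + y) ` ?E \<subseteq> ?Z"
        proof (rule image_subsetI)
          fix y assume y: "y \<in> ?E"
          then have "y \<in> ?S" by simp
          then have "\<bar>(x + y) $ i\<bar> \<le> int H" for i
            using abs_triangle_ineq[of "x $ i" "y $ i"] lattice_points_box[OF r(2) R, of y i] X[of i]
            unfolding H_def vector_add_component of_nat_add by linarith
          with y show "x + y \<in> ?Z" by simp
        qed
        have "?Z \<subseteq> {z. \<forall>i. z $ i \<in> {- int H..int H}}" by (auto simp: symmetric_interval_iff simp del: atLeastAtMost_iff)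
        then show "finite ?Z" by (rule finite_subset) (rule finite_int_box, simp)
      qed simp
      then have "real (card ?E) \<le> 1 + (3 * real H) ^ CARD('n) / real N"
        using card_large_gcd[OF d N, of H] by linarith
      also have "\<dots> \<le> r ^ CARD('n) / real N + (3 * ((R + 1) * r)) ^ CARD('n) / real N"
      proof (intro add_mono divide_right_mono power_mono mult_left_mono H)
        have "r \<le> r ^ CARD('n)" using r by (intro self_le_power) auto
        with elim have "real N \<le> r ^ CARD('n)" by linarith
        then show "1 \<le> r ^ CARD('n) / real N" using N by simp
      qed auto
      also have "\<dots> = (K / real N) * (c * r ^ CARD('n))"
        unfolding K_def power_mult_distrib using c N by (simp add: field_simps)
      finally have E: "real (card ?E) \<le> (K / real N) * (c * r ^ CARD('n))" .
      have K: "0 \<le> K / real N" using R0 c by (auto simp: K_def)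
      from E mult_left_mono[OF elim(1) K] have "real (card ?E) \<le> K / real N * real (card ?S)"
        by (rule order_trans)
      moreover have "0 < c * r ^ CARD('n)" using c r by simp
      then have "0 < real (card ?S)" using elim(1) by linarith
      ultimately show ?case by (simp only: pos_divide_le_eq)
    qed
  qed
  then show ?thesis by blast
qed

section \<open>Convergence of the shifted gcd maps\<close>

text \<open>Interchange of limits: the approximation error is small for large \<open>N\<close>, uniformly near the end of
  the filter, so \<open>lim a = lim\<^sub>N lim b N\<close>.\<close>

lemma tendsto_via_approximation:
  fixes a :: "'r \<Rightarrow> real" and b :: "nat \<Rightarrow> 'r \<Rightarrow> real"
  assumes b: "\<And>N. (b N \<longlongrightarrow> m N) F" and m: "m \<longlonglongrightarrow> l" and e: "e \<longlonglongrightarrow> 0"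
    and close: "\<And>N. N > 0 \<Longrightarrow> eventually (\<lambda>r. \<bar>a r - b N r\<bar> \<le> e N) F"
  shows "(a \<longlongrightarrow> l) F"
proof (rule tendstoI)
  fix \<epsilon> :: real assume "\<epsilon> > 0"
  then have "\<epsilon> / 3 > 0" by simp
  from tendstoD[OF m this] tendstoD[OF e this] eventually_gt_at_top[of 0]
  have "eventually (\<lambda>N. dist (m N) l < \<epsilon> / 3 \<and> dist (e N) 0 < \<epsilon> / 3 \<and> N > 0) sequentially"
    by eventually_elim simp
  then obtain N where N: "dist (m N) l < \<epsilon> / 3" "dist (e N) 0 < \<epsilon> / 3" "N > 0"
    using eventually_happens'[OF sequentially_bot] by blast
  from tendstoD[OF b \<open>\<epsilon> / 3 > 0\<close>, of N] close[OF N(3)]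
  show "eventually (\<lambda>r. dist (a r) l < \<epsilon>) F"
  proof eventually_elim
    case (elim r)
    with N show ?case unfolding dist_real_def by linarith
  qed
qed

lemma gcd_fact_eq:
  assumes "0 < k" "k \<le> N" shows "gcd k (fact N :: nat) = k"
  using dvd_fact[of k N] assms by (simp add: Suc_le_eq gcd_proj1_iff)

lemma measure_shift_distr:
  fixes c :: "int ^ 'n \<Rightarrow> 'x::topological_space"
  assumes "finite S" "S \<noteq> {}" "V \<in> sets borel"
  shows "measure (shift_distr S c) V = real (card {y \<in> S. (\<lambda>x. c (x + y)) \<in> V}) / real (card S)"
proof -
  have "measure (shift_distr S c) V =
      measure (uniform_count_measure S) ((\<lambda>y x. c (x + y)) -` V \<inter> space (uniform_count_measure S))"
    unfolding shift_distr_def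
    by (rule measure_distr) (use assms(3) in \<open>auto simp: measurable_def space_uniform_count_measure sets_uniform_count_measure\<close>)
  also have "(\<lambda>y x. c (x + y)) -` V \<inter> space (uniform_count_measure S) = {y \<in> S. (\<lambda>x. c (x + y)) \<in> V}"
    by (auto simp: space_uniform_count_measure)
  finally show ?thesis using assms(1) by (simp add: measure_uniform_count_measure)
qed

lemma prob_space_shift_distr:
  fixes c :: "int ^ 'n \<Rightarrow> 'x::topological_space"
  assumes "finite S" "S \<noteq> {}"
  shows "prob_space (shift_distr S c)"
  unfolding shift_distr_def using assms
  by (intro prob_space.prob_space_distr prob_space_uniform_count_measure)
    (auto simp: measurable_def space_uniform_count_measure sets_uniform_count_measure)

lemma eventually_lattice_points_finite_nonempty:
  fixes F :: "(real ^ 'n) set"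
  assumes "bounded F" "interior F \<noteq> {}"
  shows "eventually (\<lambda>r. finite (lattice_points F r) \<and> lattice_points F r \<noteq> {}) at_top"
proof -
  obtain c where "c > 0" and
    "eventually (\<lambda>r. c * r ^ CARD('n) \<le> real (card (lattice_points F r))) at_top"
    using card_lattice_points_ge[OF assms] by blast
  from this(2) eventually_gt_at_top[of 0] show ?thesis
  proof eventually_elim
    case (elim r)
    then have "0 < c * r ^ CARD('n)" using \<open>c > 0\<close> by simp
    with elim(1) have "0 < card (lattice_points F r)" by linarith
    then show ?case by (simp add: card_gt_0_iff)
  qed
qed

text \<open>The arithmetic counterpart of \<open>mu_inf_gcd_mod\<close>. The residue of \<open>y\<close> corresponds to \<open>- u\<close> since \<open>y\<close>
  is added in the shifted map, while \<open>u\<close> is subtracted in the random one.\<close>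

lemma gcd_mod_density:
  fixes F :: "(real ^ 'n) set"
  assumes F: "bounded F" "convex F" "interior F \<noteq> {}" and M: "M > 0"
  shows "((\<lambda>r. real (card {y \<in> lattice_points F r. \<forall>x\<in>A. gcd (gcd_map (x + y)) M = v x}) /
      real (card (lattice_points F r))) \<longlongrightarrow>
    real (card {u \<in> residues M. \<forall>x\<in>A. gcd (gcd_map (x - u)) M = v x}) / real M ^ CARD('n)) at_top"
proof -
  let ?R = "{u \<in> residues M. \<forall>x\<in>A. gcd (gcd_map (x - u)) M = v x}"
  let ?E = "\<lambda>r. {y \<in> lattice_points F r. \<forall>x\<in>A. gcd (gcd_map (x + y)) M = v x}"
  have cong: "gcd (gcd_map (x + y)) M = gcd (gcd_map (x - u)) M"
    if y: "y \<in> residue_class M (- u)" for x y u :: "int ^ 'n"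
  proof -
    have dvd: "k dvd gcd_map (x + y) \<longleftrightarrow> k dvd gcd_map (x - u)" if "k dvd M" for k
    proof -
      have "int k dvd y $ i + u $ i" for i
        using y that by (auto simp: residue_class_def intro: dvd_trans[of "int k" "int M"])
      then have "int k dvd (x $ i - u $ i) + (y $ i + u $ i) \<longleftrightarrow> int k dvd x $ i - u $ i" for i
        by (rule dvd_add_left_iff)
      then show ?thesis unfolding dvd_gcd_map_iff by (simp add: algebra_simps)
    qed
    show ?thesis
      using dvd[of "gcd (gcd_map (x + y)) M"] dvd[of "gcd (gcd_map (x - u)) M"]
      by (intro dvd_antisym gcd_greatest) auto
  qed
  have "card (?E r) = (\<Sum>u\<in>?R. card (lattice_points F r \<inter> residue_class M (- u)))"
    if "finite (lattice_points F r)" for r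
  proof -
    have "?E r = (\<Union>u\<in>?R. lattice_points F r \<inter> residue_class M (- u))"
    proof (intro equalityI subsetI)
      fix y assume y: "y \<in> ?E r"
      obtain u where u: "u \<in> residues M" "- y \<in> residue_class M u"
        using residues_exists[OF M] by blast
      then have "y \<in> residue_class M (- u)"
        by (auto simp: residue_class_def dvd_diff_commute algebra_simps)
      with y u cong show "y \<in> (\<Union>u\<in>?R. lattice_points F r \<inter> residue_class M (- u))" by force
    qed (use cong in force)
    then have "card (?E r) = card (\<Union>u\<in>?R. lattice_points F r \<inter> residue_class M (- u))"
      by (rule arg_cong)
    also have "\<dots> = (\<Sum>u\<in>?R. card (lattice_points F r \<inter> residue_class M (- u)))"
    proof (rule card_UN_disjoint)
      show "\<forall>u\<in>?R. \<forall>u'\<in>?R. u \<noteq> u' \<longrightarrow>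
        (lattice_points F r \<inter> residue_class M (- u)) \<inter> (lattice_points F r \<inter> residue_class M (- u')) = {}"
      proof (intro ballI impI, rule ccontr)
        fix u u' assume u: "u \<in> ?R" "u' \<in> ?R" "u \<noteq> u'" and
          "(lattice_points F r \<inter> residue_class M (- u)) \<inter> (lattice_points F r \<inter> residue_class M (- u')) \<noteq> {}"
        then obtain y where y: "y \<in> residue_class M (- u)" "y \<in> residue_class M (- u')" by blast
        have "int M dvd (y $ i + u' $ i) - (y $ i + u $ i)" for i
          using y by (intro dvd_diff) (auto simp: residue_class_def)
        then have "u' \<in> residue_class M u" by (simp add: residue_class_def)
        then show False using u residues_unique by blast
      qed
    qed (use that in auto)
    finally show ?thesis .
  qed
  then have eq: "eventually (\<lambda>r. real (card (?E r)) / real (card (lattice_points F r)) =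
      (\<Sum>u\<in>?R. real (card (lattice_points F r \<inter> residue_class M (- u))) / real (card (lattice_points F r)))) at_top"
    using eventually_lattice_points_finite_nonempty[OF F(1,3)]
    by (auto elim!: eventually_mono simp: sum_divide_distrib)
  have "((\<lambda>r. \<Sum>u\<in>?R. real (card (lattice_points F r \<inter> residue_class M (- u))) / real (card (lattice_points F r)))
      \<longlongrightarrow> (\<Sum>u\<in>?R. 1 / real M ^ CARD('n))) at_top"
    by (intro tendsto_sum lattice_points_equidistributed F M)
  then show ?thesis by (subst tendsto_cong[OF eq]) simp
qed

text \<open>Reduction modulo \<open>N!\<close> is harmless unless some \<open>x + y\<close> with \<open>x \<in> A\<close> has a gcd that is \<open>0\<close> or
  exceeds \<open>N\<close>.\<close>

lemma gcd_truncation_error: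
  fixes F :: "(real ^ 'n) set"
  assumes d: "CARD('n) \<ge> 2" and F: "bounded F" "interior F \<noteq> {}" and A: "finite A"
  shows "\<exists>K. \<forall>N>0. eventually (\<lambda>r. \<bar>
    real (card {y \<in> lattice_points F r. \<forall>x\<in>A. gcd_map (x + y) = v x}) / real (card (lattice_points F r)) -
    real (card {y \<in> lattice_points F r. \<forall>x\<in>A. gcd (gcd_map (x + y)) (fact N) = v x}) /
      real (card (lattice_points F r))\<bar> \<le> K / real N) at_top"
proof -
  let ?E = "\<lambda>r. {y \<in> lattice_points F r. \<forall>x\<in>A. gcd_map (x + y) = v x}"
  let ?G = "\<lambda>N r. {y \<in> lattice_points F r. \<forall>x\<in>A. gcd (gcd_map (x + y)) (fact N) = v x}"
  let ?X = "\<lambda>N r x. {y \<in> lattice_points F r. gcd_map (x + y) = 0 \<or> gcd_map (x + y) > N}"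
  obtain K where K: "\<And>x N. N > 0 \<Longrightarrow> eventually (\<lambda>r.
      real (card (?X N r x)) / real (card (lattice_points F r)) \<le> K / real N) at_top"
    using lattice_points_large_gcd[OF d F] by blast
  have "eventually (\<lambda>r. \<bar>real (card (?E r)) / real (card (lattice_points F r)) -
      real (card (?G N r)) / real (card (lattice_points F r))\<bar> \<le> real (card A) * K / real N) at_top"
    if N: "N > 0" for N
  proof -
    have "eventually (\<lambda>r. \<forall>x\<in>A. real (card (?X N r x)) / real (card (lattice_points F r)) \<le> K / real N) at_top"
      using A K[OF N] by (simp add: eventually_ball_finite)
    with eventually_lattice_points_finite_nonempty[OF F] show ?thesis
    proof eventually_elim
      case (elim r)
      define s where "s = real (card (lattice_points F r))"
      have s: "s > 0" using elim by (simp add: s_def card_gt_0_iff)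
      have fin: "finite (\<Union>x\<in>A. ?X N r x)" "finite (?E r)" "finite (?G N r)" using A elim by auto
      have good: "gcd (gcd_map (x + y)) (fact N) = gcd_map (x + y)"
        if "y \<in> lattice_points F r" "y \<notin> (\<Union>x\<in>A. ?X N r x)" "x \<in> A" for x y
        using that by (intro gcd_fact_eq) auto
      define U where "U = (\<Union>x\<in>A. ?X N r x)"
      have same: "y \<in> ?E r \<longleftrightarrow> y \<in> ?G N r" if "y \<notin> U" for y
        using good[of y] that unfolding U_def by (cases "y \<in> lattice_points F r") simp_all
      then have "?E r \<subseteq> ?G N r \<union> U" "?G N r \<subseteq> ?E r \<union> U" by blast+
      then have "card (?E r) \<le> card (?G N r \<union> U)" "card (?G N r) \<le> card (?E r \<union> U)"
        using fin unfolding U_def[symmetric] by - (intro card_mono finite_UnI; assumption)+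
      then have "card (?E r) \<le> card (?G N r) + card U" "card (?G N r) \<le> card (?E r) + card U"
        using card_Un_le[of "?G N r" U] card_Un_le[of "?E r" U] by linarith+
      then have "\<bar>real (card (?E r)) - real (card (?G N r))\<bar> \<le> real (card (\<Union>x\<in>A. ?X N r x))"
        unfolding U_def by linarith
      also have "\<dots> \<le> real (\<Sum>x\<in>A. card (?X N r x))"
        using card_UN_le[OF A, of "?X N r"] by (simp only: of_nat_le_iff)
      finally have "\<bar>real (card (?E r)) - real (card (?G N r))\<bar> / s \<le> (\<Sum>x\<in>A. real (card (?X N r x))) / s"
        using s by (intro divide_right_mono) auto
      also have "\<dots> = (\<Sum>x\<in>A. real (card (?X N r x)) / s)" by (rule sum_divide_distrib)
      also have "\<dots> \<le> (\<Sum>x\<in>A. K / real N)" using elim by (intro sum_mono) (simp add: s_def)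
      also have "\<dots> = real (card A) * K / real N" by simp
      finally have "\<bar>real (card (?E r)) - real (card (?G N r))\<bar> / s \<le> real (card A) * K / real N" .
      moreover have "\<bar>real (card (?E r)) - real (card (?G N r))\<bar> / s =
          \<bar>real (card (?E r)) / s - real (card (?G N r)) / s\<bar>"
        using s by (simp add: abs_div_pos diff_divide_distrib)
      ultimately show ?case by (simp only: s_def)
    qed
  qed
  then show ?thesis by blast
qed

theorem theorem1p1:
  fixes F :: "(real ^ 'n) set"
  assumes "CARD('n) \<ge> 2"
    and "bounded F" and "convex F" and "interior F \<noteq> {}"
  shows "converges_weakly (\<lambda>r. shift_distr (lattice_points F r) gcd_map)
           (mu_inf_gcd :: (int ^ 'n \<Rightarrow> nat) measure) at_top"
proof (rule converges_weakly_cylinders)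
  show "prob_space (mu_inf_gcd :: (int ^ 'n \<Rightarrow> nat) measure)" by (rule prob_space_mu_inf_gcd)
  show "sets (mu_inf_gcd :: (int ^ 'n \<Rightarrow> nat) measure) = sets borel" by (simp add: mu_inf_gcd_def)
  note nonempty = eventually_lattice_points_finite_nonempty[OF assms(2,4)]
  then show "eventually (\<lambda>r. prob_space (shift_distr (lattice_points F r) gcd_map) \<and>
      sets (shift_distr (lattice_points F r) gcd_map) = sets borel) at_top"
    by eventually_elim (auto simp: prob_space_shift_distr shift_distr_def[abs_def] intro!: prob_space_shift_distr[unfolded shift_distr_def])
  fix A :: "(int ^ 'n) set" and v :: "int ^ 'n \<Rightarrow> nat"
  assume A: "finite A"
  let ?a = "\<lambda>r. real (card {y \<in> lattice_points F r. \<forall>x\<in>A. gcd_map (x + y) = v x}) /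
    real (card (lattice_points F r))"
  let ?b = "\<lambda>N r. real (card {y \<in> lattice_points F r. \<forall>x\<in>A. gcd (gcd_map (x + y)) (fact N) = v x}) /
    real (card (lattice_points F r))"
  obtain K where K: "\<And>N. N > 0 \<Longrightarrow> eventually (\<lambda>r. \<bar>?a r - ?b N r\<bar> \<le> K / real N) at_top"
    using gcd_truncation_error[OF assms(1,2,4) A, of v] by blast
  have "(?a \<longlongrightarrow> measure mu_inf_gcd (cylinder A v)) at_top"
  proof (rule tendsto_via_approximation[OF _ _ _ K])
    show "(?b N \<longlongrightarrow> measure mu_inf_gcd {\<omega>. \<forall>x\<in>A. gcd (\<omega> x) (fact N) = v x}) at_top" for N
      unfolding mu_inf_gcd_mod[OF assms(1) fact_gt_zero A] by (rule gcd_mod_density) (use assms in auto)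
    show "(\<lambda>N. measure mu_inf_gcd {\<omega>. \<forall>x\<in>A. gcd (\<omega> x) (fact N) = v x}) \<longlonglongrightarrow>
        measure mu_inf_gcd (cylinder A v)"
      unfolding cylinder_def by (rule mu_inf_gcd_cylinder_limit[OF assms(1) A])
    show "(\<lambda>N. K / real N) \<longlonglongrightarrow> 0" by (rule lim_const_over_n)
  qed
  moreover have "eventually (\<lambda>r. measure (shift_distr (lattice_points F r) gcd_map) (cylinder A v) = ?a r) at_top"
    using nonempty
  proof eventually_elim
    case (elim r)
    then show ?case using A by (subst measure_shift_distr) (auto simp: cylinder_def)
  qed
  ultimately show "((\<lambda>r. measure (shift_distr (lattice_points F r) gcd_map) (cylinder A v)) \<longlongrightarrow>
      measure mu_inf_gcd (cylinder A v)) at_top"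
    by (simp add: tendsto_cong)
qed

end
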